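(* Let $\Omega\subseteq\mathbb{R}^p$ be open, $f\in\mathcal{G}(\Omega)$, $x_0\in\Omega$, $Df(x_0)=0$ in $\tilde{\mathbb{R}}^p$, and let $D^2f(\tilde x)$ be positive semidefinite for all $\tilde x\in\tilde\Omega'_c$, where $\Omega'$ is a neighborhood of $x_0$ in $\Omega$ that is star-shaped with respect to $x_0$. Then $x_0$ is a minimum of $f$ in $\tilde\Omega'_c$, i.e. $f(x_0)\le f(\tilde x)$ for all $\tilde x\in\tilde\Omega'_c$. If in addition $D^2f(\tilde x)$ is positive definite for all $\tilde x\in\tilde\Omega'_c$, then the minimum is unique on $\tilde\Omega'_c$ (i.e. $x_0$ is the only point of $\tilde\Omega'_c$ at which the minimum is attained).
   Context: $\mathcal{G}(\Omega)=\mathcal{E}_M(\Omega)/\mathcal{N}(\Omega)$ is the (special) Colombeau algebra: $\mathcal{E}_M(\Omega)$ is the set of nets $(u_\varepsilon)_{\varepsilon\in(0,1]}$ in $C^\infty(\Omega)$ such that for every compact $K\subset\Omega$ and every multi-index $\alpha$ there is $N\in\mathbb{N}$ with $\sup_K|\partial^\alpha u_\varepsilon|=O(\varepsilon^{-N})$ as $\varepsilon\to0$; $\mathcal{N}(\Omega)$ is the set of nets such that for all such $K,\alpha$ and all $m\in\mathbb{N}$, $\sup_K|\partial^\alpha u_\varepsilon|=O(\varepsilon^m)$. Derivatives are componentwise. $\tilde{\mathbb{R}}$ is the ring of nets of reals with $|x_\varepsilon|=O(\varepsilon^{-N})$ for some $N$, modulo nets with $|x_\varepsilon|=O(\varepsilon^m)$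 for all $m$. $\tilde x\ge0$ in $\tilde{\mathbb{R}}$ means that $\tilde x$ has a representative with all $x_\varepsilon\ge0$; $\tilde x\le\tilde y$ means $\tilde y-\tilde x\ge0$; $\tilde x$ is strictly positive if it is $\ge0$ and invertible in $\tilde{\mathbb{R}}$. $\tilde\Omega_c$ denotes the set of compactly supported generalized points of $\Omega$: equivalence classes of nets $(x_\varepsilon)_\varepsilon$ in $\Omega$ which lie in a fixed compact subset of $\Omega$ for all sufficiently small $\varepsilon$, two nets being equivalent if $|x_\varepsilon-y_\varepsilon|=O(\varepsilon^m)$ for all $m$; $\tilde\Omega'_c$ is defined likewise. Points of $\Omega$ are identified with constant nets. For $f=[(f_\varepsilon)_\varepsilon]\in\mathcal{G}(\Omega)$ and $\tilde x=[(x_\varepsilon)_\varepsilon]\in\tilde\Omega_c$, $f(\tilde x)=[(f_\varepsilon(x_\varepsilon))_\varepsilon]\in\tilde{\mathbb{R}}$. A symmetric matrix $A\in\tilde{\mathbb{R}}^{p^2}$ is positive semidefinite if $\tilde\xi^{T}A\tilde\xi\ge0$ for all $\tilde\xi\in\tilde{\mathbb{R}}^p$. A vector $\tilde\xi\in\tilde{\mathbb{R}}^p$, $\tilde\xi\neq0$, is free if $\tilde\lambda\in\tilde{\mathbb{R}}$ and $\tilde\lambda\tilde\xi=0$ imply $\tilde\lambda=0$. $A$ is positive definite if $\tilde\xi^{T}A\tilde\xi$ is strictly positive for all free $\tilde\xi\in\tilde{\mathbb{R}}^p$. *)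

theory Defs
  imports "HOL-Analysis.Analysis" "HOL-Library.Landau_Symbols"
begin

text \<open>
  A net indexed by \<open>\<epsilon> \<in> (0,1]\<close> is represented by a function on all of \<^typ>\<open>real\<close>. Only its values
  on \<open>{0<..1}\<close> are ever constrained, and the asymptotic conditions only concern \<open>at_right 0\<close>,
  so the equivalence classes below do not see the values outside \<open>{0<..1}\<close>.
\<close>

section \<open>Generalized numbers\<close>

definition moderate :: "(real \<Rightarrow> real) \<Rightarrow> bool" where
  "moderate x \<longleftrightarrow> (\<exists>N::nat. x \<in> O[at_right 0](\<lambda>\<epsilon>. 1 / \<epsilon> ^ N))"

definition negligible_net :: "(real \<Rightarrow> real) \<Rightarrow> bool" where
  "negligible_net x \<longleftrightarrow> (\<forall>m::nat. x \<in> O[at_right 0](\<lambda>\<epsilon>. \<epsilon> ^ m))"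

lemma inverse_power_bigo:
  assumes "M \<le> N"
  shows "(\<lambda>\<epsilon>::real. 1 / \<epsilon> ^ M) \<in> O[at_right 0](\<lambda>\<epsilon>. 1 / \<epsilon> ^ N)"
proof (rule bigoI[of _ 1])
  have "\<forall>\<^sub>F \<epsilon>::real in at_right 0. \<epsilon> \<in> {0<..<1}"
    by (rule eventually_at_right_real) simp
  then show "\<forall>\<^sub>F \<epsilon>::real in at_right 0. norm (1 / \<epsilon> ^ M) \<le> 1 * norm (1 / \<epsilon> ^ N)"
  proof eventually_elim
    case (elim \<epsilon>)
    then have "\<epsilon> ^ N \<le> \<epsilon> ^ M" "0 < \<epsilon> ^ N"
      using assms by (auto intro: power_decreasing)
    then show ?case
      using elim by (simp add: frac_le)
  qed
qed

lemma moderate_const: "moderate (\<lambda>_. c)"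
  unfolding moderate_def by (rule exI[of _ 0]) simp

lemma moderate_add:
  assumes "moderate x" "moderate y"
  shows "moderate (\<lambda>\<epsilon>. x \<epsilon> + y \<epsilon>)"
proof -
  obtain M N where M: "x \<in> O[at_right 0](\<lambda>\<epsilon>. 1 / \<epsilon> ^ M)" and N: "y \<in> O[at_right 0](\<lambda>\<epsilon>. 1 / \<epsilon> ^ N)"
    using assms unfolding moderate_def by blast
  have "x \<in> O[at_right 0](\<lambda>\<epsilon>. 1 / \<epsilon> ^ max M N)" "y \<in> O[at_right 0](\<lambda>\<epsilon>. 1 / \<epsilon> ^ max M N)"
    using landau_o.big_trans[OF M inverse_power_bigo[of M "max M N"]]
      landau_o.big_trans[OF N inverse_power_bigo[of N "max M N"]] by simp_all
  then show ?thesis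
    unfolding moderate_def using sum_in_bigo(1) by blast
qed

lemma moderate_uminus: "moderate x \<Longrightarrow> moderate (\<lambda>\<epsilon>. - x \<epsilon>)"
  by (simp add: moderate_def)

lemma moderate_mult:
  assumes "moderate x" "moderate y"
  shows "moderate (\<lambda>\<epsilon>. x \<epsilon> * y \<epsilon>)"
proof -
  obtain M N where M: "x \<in> O[at_right 0](\<lambda>\<epsilon>. 1 / \<epsilon> ^ M)" and N: "y \<in> O[at_right 0](\<lambda>\<epsilon>. 1 / \<epsilon> ^ N)"
    using assms unfolding moderate_def by blast
  from landau_o.big.mult[OF M N] show ?thesis
    unfolding moderate_def by (intro exI[of _ "M + N"]) (simp add: power_add)
qed

lemma negligible_net_zero: "negligible_net (\<lambda>_. 0)"
  by (simp add: negligible_net_def)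

lemma negligible_net_add:
  "negligible_net x \<Longrightarrow> negligible_net y \<Longrightarrow> negligible_net (\<lambda>\<epsilon>. x \<epsilon> + y \<epsilon>)"
  by (simp add: negligible_net_def sum_in_bigo)

lemma negligible_net_uminus: "negligible_net x \<Longrightarrow> negligible_net (\<lambda>\<epsilon>. - x \<epsilon>)"
  by (simp add: negligible_net_def)

lemma negligible_net_mult:
  assumes "moderate x" "negligible_net y"
  shows "negligible_net (\<lambda>\<epsilon>. x \<epsilon> * y \<epsilon>)"
  unfolding negligible_net_def
proof
  fix m
  obtain N where N: "x \<in> O[at_right 0](\<lambda>\<epsilon>. 1 / \<epsilon> ^ N)"
    using assms unfolding moderate_def by blast
  have "y \<in> O[at_right 0](\<lambda>\<epsilon>. \<epsilon> ^ (N + m))"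
    using assms(2) unfolding negligible_net_def by blast
  from landau_o.big.mult[OF N this]
  have "(\<lambda>\<epsilon>. x \<epsilon> * y \<epsilon>) \<in> O[at_right 0](\<lambda>\<epsilon>. 1 / \<epsilon> ^ N * \<epsilon> ^ (N + m))" .
  also have "(\<lambda>\<epsilon>::real. 1 / \<epsilon> ^ N * \<epsilon> ^ (N + m)) \<in> O[at_right 0](\<lambda>\<epsilon>. \<epsilon> ^ m)"
  proof (rule bigoI[of _ 1])
    have "\<forall>\<^sub>F \<epsilon>::real in at_right 0. \<epsilon> \<in> {0<..<1}"
      by (rule eventually_at_right_real) simp
    then show "\<forall>\<^sub>F \<epsilon>::real in at_right 0. norm (1 / \<epsilon> ^ N * \<epsilon> ^ (N + m)) \<le> 1 * norm (\<epsilon> ^ m)"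
      by eventually_elim (simp add: power_add)
  qed
  finally show "(\<lambda>\<epsilon>. x \<epsilon> * y \<epsilon>) \<in> O[at_right 0](\<lambda>\<epsilon>. \<epsilon> ^ m)" .
qed

definition gen_real_rel :: "(real \<Rightarrow> real) \<Rightarrow> (real \<Rightarrow> real) \<Rightarrow> bool" where
  "gen_real_rel x y \<longleftrightarrow> moderate x \<and> moderate y \<and> negligible_net (\<lambda>\<epsilon>. x \<epsilon> - y \<epsilon>)"

lemma gen_real_rel_refl: "gen_real_rel x x \<longleftrightarrow> moderate x"
  by (simp add: gen_real_rel_def negligible_net_zero)

lemma part_equivp_gen_real_rel: "part_equivp gen_real_rel"
proof (rule part_equivpI)
  show "\<exists>x. gen_real_rel x x"
    using moderate_const gen_real_rel_refl by blast
  show "symp gen_real_rel"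
    by (rule sympI) (auto simp: gen_real_rel_def dest: negligible_net_uminus)
  show "transp gen_real_rel"
  proof (rule transpI)
    fix x y z
    assume "gen_real_rel x y" "gen_real_rel y z"
    then show "gen_real_rel x z"
      using negligible_net_add[of "\<lambda>\<epsilon>. x \<epsilon> - y \<epsilon>" "\<lambda>\<epsilon>. y \<epsilon> - z \<epsilon>"]
      by (simp add: gen_real_rel_def)
  qed
qed

quotient_type gen_real = "real \<Rightarrow> real" / partial: gen_real_rel
  morphisms rep_gen_real GenReal
  by (rule part_equivp_gen_real_rel)

instantiation gen_real :: comm_ring_1
begin

lift_definition zero_gen_real :: gen_real is "\<lambda>_. 0"
  by (simp add: gen_real_rel_refl moderate_const)

lift_definition one_gen_real :: gen_real is "\<lambda>_. 1"
  by (simp add: gen_real_rel_refl moderate_const)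

lift_definition plus_gen_real :: "gen_real \<Rightarrow> gen_real \<Rightarrow> gen_real" is "\<lambda>x y \<epsilon>. x \<epsilon> + y \<epsilon>"
  subgoal for x x' y y'
    using negligible_net_add[of "\<lambda>\<epsilon>. x \<epsilon> - x' \<epsilon>" "\<lambda>\<epsilon>. y \<epsilon> - y' \<epsilon>"]
    by (simp add: gen_real_rel_def moderate_add algebra_simps)
  done

lift_definition uminus_gen_real :: "gen_real \<Rightarrow> gen_real" is "\<lambda>x \<epsilon>. - x \<epsilon>"
  subgoal for x x'
    using negligible_net_uminus[of "\<lambda>\<epsilon>. x \<epsilon> - x' \<epsilon>"]
    by (simp add: gen_real_rel_def moderate_uminus)
  done

lift_definition times_gen_real :: "gen_real \<Rightarrow> gen_real \<Rightarrow> gen_real" is "\<lambda>x y \<epsilon>. x \<epsilon> * y \<epsilon>"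
  subgoal for x x' y y'
    using negligible_net_add[OF negligible_net_mult[of x "\<lambda>\<epsilon>. y \<epsilon> - y' \<epsilon>"]
        negligible_net_mult[of y' "\<lambda>\<epsilon>. x \<epsilon> - x' \<epsilon>"]]
    by (simp add: gen_real_rel_def moderate_mult algebra_simps)
  done

definition minus_gen_real :: "gen_real \<Rightarrow> gen_real \<Rightarrow> gen_real" where
  "minus_gen_real x y = x + - y"

instance
proof
  fix a b c :: gen_real
  show "a + b + c = a + (b + c)"
    by transfer (simp add: gen_real_rel_refl moderate_add add.assoc)
  show "a + b = b + a"
    by transfer (simp add: gen_real_rel_refl moderate_add add.commute)
  show "0 + a = a"
    by transfer (simp add: gen_real_rel_refl)
  show "- a + a = 0"
    by transfer (simp add: gen_real_rel_refl moderate_const)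
  show "a - b = a + - b"
    by (simp add: minus_gen_real_def)
  show "a * b * c = a * (b * c)"
    by transfer (simp add: gen_real_rel_refl moderate_mult mult.assoc)
  show "a * b = b * a"
    by transfer (simp add: gen_real_rel_refl moderate_mult mult.commute)
  show "1 * a = a"
    by transfer (simp add: gen_real_rel_refl)
  show "(a + b) * c = a * c + b * c"
    by transfer (simp add: gen_real_rel_refl moderate_mult moderate_add distrib_right)
  show "(0::gen_real) \<noteq> 1"
  proof
    assume "(0::gen_real) = 1"
    then have "negligible_net (\<lambda>_. 0 - 1)"
      by transfer (simp add: gen_real_rel_def)
    then have "(\<lambda>_. 0 - 1 :: real) \<in> O[at_right 0](\<lambda>\<epsilon>::real. \<epsilon> ^ 1)"
      unfolding negligible_net_def by blast
    then have "(\<lambda>_. 1 :: real) \<in> O[at_right 0](\<lambda>\<epsilon>::real. \<epsilon>)"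
      by simp
    moreover have "(\<lambda>\<epsilon>::real. \<epsilon>) \<in> o[at_right 0](\<lambda>_. 1 :: real)"
      by (rule smalloI_tendsto) (auto intro!: tendsto_eq_intros)
    ultimately have "(\<lambda>_. 1 :: real) \<in> o[at_right (0::real)](\<lambda>_. 1 :: real)"
      by (rule landau_o.big_small_trans)
    then show False
      by (simp add: landau_o.small_refl_iff)
  qed
qed

end

definition gen_nonneg :: "gen_real \<Rightarrow> bool" where
  "gen_nonneg a \<longleftrightarrow> (\<exists>x. moderate x \<and> a = GenReal x \<and> (\<forall>\<epsilon>\<in>{0<..1}. 0 \<le> x \<epsilon>))"


lemma GenReal_eq_iff:
  "moderate x \<Longrightarrow> moderate y \<Longrightarrow> GenReal x = GenReal y \<longleftrightarrow> negligible_net (\<lambda>\<epsilon>. x \<epsilon> - y \<epsilon>)"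
  using Quotient_rel[OF Quotient_gen_real, of x y]
  by (simp add: gen_real_rel_def negligible_net_zero)

lemma GenReal_zero: "0 = GenReal (\<lambda>_. 0)"
  by (simp add: zero_gen_real_def)

lemma GenReal_add: "moderate x \<Longrightarrow> moderate y \<Longrightarrow> GenReal x + GenReal y = GenReal (\<lambda>\<epsilon>. x \<epsilon> + y \<epsilon>)"
  by (rule plus_gen_real.abs_eq) (simp_all add: gen_real_rel_refl)

lemma GenReal_mult: "moderate x \<Longrightarrow> moderate y \<Longrightarrow> GenReal x * GenReal y = GenReal (\<lambda>\<epsilon>. x \<epsilon> * y \<epsilon>)"
  by (rule times_gen_real.abs_eq) (simp_all add: gen_real_rel_refl)

lemma gen_nonneg_zero: "gen_nonneg 0"
  unfolding gen_nonneg_def GenReal_zero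
  by (rule exI[of _ "\<lambda>_. 0"]) (simp add: moderate_const)

lemma gen_nonneg_add:
  assumes "gen_nonneg a" "gen_nonneg b"
  shows "gen_nonneg (a + b)"
proof -
  obtain x y where x: "moderate x" "a = GenReal x" "\<forall>\<epsilon>\<in>{0<..1}. 0 \<le> x \<epsilon>"
    and y: "moderate y" "b = GenReal y" "\<forall>\<epsilon>\<in>{0<..1}. 0 \<le> y \<epsilon>"
    using assms unfolding gen_nonneg_def by blast
  show ?thesis
    unfolding gen_nonneg_def
    by (rule exI[of _ "\<lambda>\<epsilon>. x \<epsilon> + y \<epsilon>"])
      (use x y in \<open>simp add: GenReal_add moderate_add\<close>)
qed

lemma gen_nonneg_mult:
  assumes "gen_nonneg a" "gen_nonneg b"
  shows "gen_nonneg (a * b)"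
proof -
  obtain x y where x: "moderate x" "a = GenReal x" "\<forall>\<epsilon>\<in>{0<..1}. 0 \<le> x \<epsilon>"
    and y: "moderate y" "b = GenReal y" "\<forall>\<epsilon>\<in>{0<..1}. 0 \<le> y \<epsilon>"
    using assms unfolding gen_nonneg_def by blast
  show ?thesis
    unfolding gen_nonneg_def
    by (rule exI[of _ "\<lambda>\<epsilon>. x \<epsilon> * y \<epsilon>"])
      (use x y in \<open>simp add: GenReal_mult moderate_mult\<close>)
qed

lemma gen_nonneg_antisym:
  assumes "gen_nonneg a" "gen_nonneg (- a)"
  shows "a = 0"
proof -
  obtain x y where x: "moderate x" "a = GenReal x" "\<forall>\<epsilon>\<in>{0<..1}. 0 \<le> x \<epsilon>"
    and y: "moderate y" "- a = GenReal y" "\<forall>\<epsilon>\<in>{0<..1}. 0 \<le> y \<epsilon>"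
    using assms unfolding gen_nonneg_def by blast
  have "GenReal (\<lambda>\<epsilon>. x \<epsilon> + y \<epsilon>) = GenReal (\<lambda>_. 0)"
    using GenReal_add[OF x(1) y(1)] x(2) y(2) by (metis GenReal_zero add.right_inverse)
  then have neg: "negligible_net (\<lambda>\<epsilon>. x \<epsilon> + y \<epsilon>)"
    using GenReal_eq_iff[OF moderate_add[OF x(1) y(1)] moderate_const] by simp
  have "negligible_net x"
    unfolding negligible_net_def
  proof
    fix m
    have "\<forall>\<^sub>F \<epsilon>::real in at_right 0. \<epsilon> \<in> {0<..<1}"
      by (rule eventually_at_right_real) simp
    then have "\<forall>\<^sub>F \<epsilon> in at_right 0. norm (x \<epsilon>) \<le> 1 * norm (x \<epsilon> + y \<epsilon>)"
      by eventually_elim (use x(3) y(3) in auto)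
    then have "x \<in> O[at_right 0](\<lambda>\<epsilon>. x \<epsilon> + y \<epsilon>)"
      by (rule bigoI)
    also have "(\<lambda>\<epsilon>. x \<epsilon> + y \<epsilon>) \<in> O[at_right 0](\<lambda>\<epsilon>. \<epsilon> ^ m)"
      using neg unfolding negligible_net_def by blast
    finally show "x \<in> O[at_right 0](\<lambda>\<epsilon>. \<epsilon> ^ m)" .
  qed
  then show ?thesis
    using x GenReal_eq_iff[OF x(1) moderate_const] by (simp add: GenReal_zero)
qed

instantiation gen_real :: ordered_comm_ring
begin

definition less_eq_gen_real :: "gen_real \<Rightarrow> gen_real \<Rightarrow> bool" where
  "a \<le> b \<longleftrightarrow> gen_nonneg (b - a)"

definition less_gen_real :: "gen_real \<Rightarrow> gen_real \<Rightarrow> bool" where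
  "(a::gen_real) < b \<longleftrightarrow> a \<le> b \<and> \<not> b \<le> a"

instance
proof
  fix a b c :: gen_real
  show "a \<le> a"
    by (simp add: less_eq_gen_real_def gen_nonneg_zero)
  show "a < b \<longleftrightarrow> a \<le> b \<and> \<not> b \<le> a"
    by (rule less_gen_real_def)
  show "a \<le> c" if "a \<le> b" "b \<le> c"
    using gen_nonneg_add[of "b - a" "c - b"] that by (simp add: less_eq_gen_real_def)
  show "a = b" if "a \<le> b" "b \<le> a"
    using gen_nonneg_antisym[of "b - a"] that by (simp add: less_eq_gen_real_def)
  show "c + a \<le> c + b" if "a \<le> b"
    using that by (simp add: less_eq_gen_real_def)
  show "c * a \<le> c * b" if "a \<le> b" "0 \<le> c"
    using gen_nonneg_mult[of c "b - a"] that by (simp add: less_eq_gen_real_def right_diff_distrib)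
qed

end

text \<open>This is not \<open>0 < a\<close> for the order above, since \<^typ>\<open>gen_real\<close> has zero divisors.\<close>

definition strictly_positive :: "gen_real \<Rightarrow> bool" where
  "strictly_positive a \<longleftrightarrow> 0 \<le> a \<and> a dvd 1"


section \<open>Vectors and matrices over the generalized numbers\<close>

definition free_vector :: "gen_real ^ 'n \<Rightarrow> bool" where
  "free_vector \<xi> \<longleftrightarrow> \<xi> \<noteq> 0 \<and> (\<forall>c. c *s \<xi> = 0 \<longrightarrow> c = 0)"

definition pos_semidefinite :: "gen_real ^ 'n ^ 'n \<Rightarrow> bool" where
  "pos_semidefinite A \<longleftrightarrow> transpose A = A \<and> (\<forall>\<xi>. 0 \<le> scalar_product \<xi> (A *v \<xi>))"

definition pos_definite :: "gen_real ^ 'n ^ 'n \<Rightarrow> bool" where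
  "pos_definite A \<longleftrightarrow>
     transpose A = A \<and> (\<forall>\<xi>. free_vector \<xi> \<longrightarrow> strictly_positive (scalar_product \<xi> (A *v \<xi>)))"


section \<open>Smooth functions and the Colombeau algebra\<close>

definition partial_deriv :: "'n \<Rightarrow> (real ^ 'n \<Rightarrow> real) \<Rightarrow> real ^ 'n \<Rightarrow> real" where
  "partial_deriv i f x = frechet_derivative f (at x) (axis i 1)"

text \<open>
  Iterated partial derivatives are indexed by lists of coordinate directions. On smooth functions
  the order of the directions is irrelevant, and the lists range over exactly the derivatives
  \<open>\<partial>\<^sup>\<alpha>\<close> for multi-indices \<open>\<alpha>\<close> (the multiplicity of \<open>i\<close> in the list being \<open>\<alpha>\<^sub>i\<close>).
\<close>

definition iter_partial :: "'n list \<Rightarrow> (real ^ 'n \<Rightarrow> real) \<Rightarrow> real ^ 'n \<Rightarrow> real" where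
  "iter_partial is f = foldr partial_deriv is f"

text \<open>
  On an open set this is \<open>C\<^sup>\<infinity>\<close>: all iterated partial derivatives exist and are (differentiable, hence)
  continuous.
\<close>

definition smooth_on :: "(real ^ 'n) set \<Rightarrow> (real ^ 'n \<Rightarrow> real) \<Rightarrow> bool" where
  "smooth_on \<Omega> f \<longleftrightarrow> (\<forall>is. iter_partial is f differentiable_on \<Omega>)"

text \<open>The condition \<open>K \<noteq> {}\<close> only avoids the unspecified supremum of the empty set of reals.\<close>

definition moderate_functions :: "(real ^ 'n) set \<Rightarrow> (real \<Rightarrow> real ^ 'n \<Rightarrow> real) set" where
  "moderate_functions \<Omega> = {u. (\<forall>\<epsilon>\<in>{0<..1}. smooth_on \<Omega> (u \<epsilon>)) \<and>
     (\<forall>K is. compact K \<and> K \<noteq> {} \<and> K \<subseteq> \<Omega> \<longrightarrow>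
        (\<exists>N::nat. (\<lambda>\<epsilon>. SUP x\<in>K. \<bar>iter_partial is (u \<epsilon>) x\<bar>) \<in> O[at_right 0](\<lambda>\<epsilon>. 1 / \<epsilon> ^ N)))}"

definition negligible_functions :: "(real ^ 'n) set \<Rightarrow> (real \<Rightarrow> real ^ 'n \<Rightarrow> real) set" where
  "negligible_functions \<Omega> = {u. (\<forall>\<epsilon>\<in>{0<..1}. smooth_on \<Omega> (u \<epsilon>)) \<and>
     (\<forall>K is. compact K \<and> K \<noteq> {} \<and> K \<subseteq> \<Omega> \<longrightarrow>
        (\<forall>m::nat. (\<lambda>\<epsilon>. SUP x\<in>K. \<bar>iter_partial is (u \<epsilon>) x\<bar>) \<in> O[at_right 0](\<lambda>\<epsilon>. \<epsilon> ^ m)))}"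

definition colombeau_rel ::
    "(real ^ 'n) set \<Rightarrow> ((real \<Rightarrow> real ^ 'n \<Rightarrow> real) \<times> (real \<Rightarrow> real ^ 'n \<Rightarrow> real)) set" where
  "colombeau_rel \<Omega> = {(u, v). u \<in> moderate_functions \<Omega> \<and> v \<in> moderate_functions \<Omega> \<and>
     (\<lambda>\<epsilon> x. u \<epsilon> x - v \<epsilon> x) \<in> negligible_functions \<Omega>}"

definition colombeau_algebra :: "(real ^ 'n) set \<Rightarrow> (real \<Rightarrow> real ^ 'n \<Rightarrow> real) set set" where
  "colombeau_algebra \<Omega> = moderate_functions \<Omega> // colombeau_rel \<Omega>"

text \<open>For \<open>F = [(f\<^sub>\<epsilon>)]\<close> this is the class of \<open>(\<partial>\<^sub>i f\<^sub>\<epsilon>)\<close>.\<close>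

definition colombeau_partial ::
    "(real ^ 'n) set \<Rightarrow> 'n \<Rightarrow> (real \<Rightarrow> real ^ 'n \<Rightarrow> real) set \<Rightarrow> (real \<Rightarrow> real ^ 'n \<Rightarrow> real) set" where
  "colombeau_partial \<Omega> i F = colombeau_rel \<Omega> `` ((\<lambda>f \<epsilon>. partial_deriv i (f \<epsilon>)) ` F)"


section \<open>Compactly supported generalized points and point values\<close>

definition compact_nets :: "(real ^ 'n) set \<Rightarrow> (real \<Rightarrow> real ^ 'n) set" where
  "compact_nets \<Omega> = {x. (\<forall>\<epsilon>\<in>{0<..1}. x \<epsilon> \<in> \<Omega>) \<and>
     (\<exists>K. compact K \<and> K \<subseteq> \<Omega> \<and> (\<forall>\<^sub>F \<epsilon> in at_right 0. x \<epsilon> \<in> K))}"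

definition point_rel :: "(real ^ 'n) set \<Rightarrow> ((real \<Rightarrow> real ^ 'n) \<times> (real \<Rightarrow> real ^ 'n)) set" where
  "point_rel \<Omega> = {(x, y). x \<in> compact_nets \<Omega> \<and> y \<in> compact_nets \<Omega> \<and>
     negligible_net (\<lambda>\<epsilon>. norm (x \<epsilon> - y \<epsilon>))}"

definition gen_points :: "(real ^ 'n) set \<Rightarrow> (real \<Rightarrow> real ^ 'n) set set" where
  "gen_points \<Omega> = compact_nets \<Omega> // point_rel \<Omega>"

definition std_point :: "(real ^ 'n) set \<Rightarrow> real ^ 'n \<Rightarrow> (real \<Rightarrow> real ^ 'n) set" where
  "std_point \<Omega> x = point_rel \<Omega> `` {\<lambda>_. x}"

text \<open>
  \<open>f(x) = [(f\<^sub>\<epsilon>(x\<^sub>\<epsilon>))]\<close>. For \<open>F \<in> colombeau_algebra \<Omega>\<close>, this is applied to \<open>X \<in> gen_points \<Omega>'\<close> with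
  \<open>\<Omega>' \<subseteq> \<Omega>\<close>: such an \<open>X\<close> is contained in a unique element of \<open>gen_points \<Omega>\<close>, at which \<open>F\<close> has the
  same value.
\<close>

definition point_value ::
    "(real \<Rightarrow> real ^ 'n \<Rightarrow> real) set \<Rightarrow> (real \<Rightarrow> real ^ 'n) set \<Rightarrow> gen_real" where
  "point_value F X = (THE r. \<exists>f\<in>F. \<exists>x\<in>X. r = GenReal (\<lambda>\<epsilon>. f \<epsilon> (x \<epsilon>)))"

definition gen_gradient ::
    "(real ^ 'n) set \<Rightarrow> (real \<Rightarrow> real ^ 'n \<Rightarrow> real) set \<Rightarrow> (real \<Rightarrow> real ^ 'n) set \<Rightarrow> gen_real ^ 'n" where
  "gen_gradient \<Omega> F X = (\<chi> i. point_value (colombeau_partial \<Omega> i F) X)"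

definition gen_hessian ::
    "(real ^ 'n) set \<Rightarrow> (real \<Rightarrow> real ^ 'n \<Rightarrow> real) set \<Rightarrow> (real \<Rightarrow> real ^ 'n) set \<Rightarrow> gen_real ^ 'n ^ 'n" where
  "gen_hessian \<Omega> F X =
     (\<chi> i j. point_value (colombeau_partial \<Omega> i (colombeau_partial \<Omega> j F)) X)"

definition minimum_point ::
    "(real \<Rightarrow> real ^ 'n \<Rightarrow> real) set \<Rightarrow> (real \<Rightarrow> real ^ 'n) set set \<Rightarrow> (real \<Rightarrow> real ^ 'n) set \<Rightarrow> bool" where
  "minimum_point F S X \<longleftrightarrow> X \<in> S \<and> (\<forall>Y\<in>S. point_value F X \<le> point_value F Y)"

end

theory Submission
  imports Defs
begin

text \<open>
  Fix representatives \<open>f\<^sub>\<epsilon>\<close> of \<open>F\<close> and \<open>x\<^sub>\<epsilon>\<close> of a generalized point \<open>X\<close>, and put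
  \<open>h\<^sub>\<epsilon> = x\<^sub>\<epsilon> - x\<^sub>0\<close>. For every \<open>\<epsilon>\<close>, Taylor's formula with the Lagrange remainder gives
  \<open>f\<^sub>\<epsilon>(x\<^sub>\<epsilon>) - f\<^sub>\<epsilon>(x\<^sub>0) = Df\<^sub>\<epsilon>(x\<^sub>0) h\<^sub>\<epsilon> + 1/2 h\<^sub>\<epsilon>\<^sup>T D\<^sup>2f\<^sub>\<epsilon>(y\<^sub>\<epsilon>) h\<^sub>\<epsilon>\<close> with \<open>y\<^sub>\<epsilon>\<close> on the segment from
  \<open>x\<^sub>0\<close> to \<open>x\<^sub>\<epsilon>\<close>. The Lagrange form is convenient here because the intermediate points are
  themselves a net: star-shapedness keeps it in \<open>\<Omega>'\<close> and inside one compact set, so it is again a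
  generalized point \<open>Y\<close> (\<open>compact_nets_star_shaped\<close>). Since the gradient at \<open>x\<^sub>0\<close> vanishes as a
  generalized vector, the formula passes to the quotient as
  \<open>F(X) - F(x\<^sub>0) = 1/2 \<xi>\<^sup>T D\<^sup>2F(Y) \<xi>\<close>, where \<open>\<xi>\<close> is the class of \<open>h\<^sub>\<epsilon>\<close>
  (\<open>point_value_Taylor\<close>). Semidefiniteness of the Hessian at \<open>Y\<close> makes this nonnegative.

  If \<open>F(X) = F(x\<^sub>0)\<close>, then \<open>\<xi>\<^sup>T D\<^sup>2F(Y) \<xi> = 0\<close>, and definiteness has to give \<open>\<xi> = 0\<close>. This is
  not immediate, as a nonzero \<open>\<xi>\<close> need not be free: it may vanish for some of the \<open>\<epsilon>\<close>. But
  if \<open>\<xi> \<noteq> 0\<close>, then on some set \<open>S\<close> of indices accumulating at 0 its norm is bounded below by a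
  power of \<open>\<epsilon>\<close>. Normalizing it there, and choosing any unit vector elsewhere, produces a free
  vector \<open>Z\<close> that agrees with a multiple of \<open>\<xi>\<close> on \<open>S\<close>
  (\<open>nonzero_vector_polar_part\<close>). The quadratic form at \<open>Z\<close> is invertible and yet vanishes on \<open>S\<close>,
  a contradiction (\<open>pos_definite_quadratic_form_eq_0\<close>).

  The remaining work shows that the classes involved can be computed on representatives
  (\<open>point_value_eq\<close>, \<open>gen_gradient_eq\<close>, \<open>gen_hessian_eq\<close>). It rests on one observation: suprema
  over a compact set are attained, so moderateness or negligibility of a net of functions means the
  same for the values of its derivatives along all nets of points in a compact set
  (\<open>seminorm_bound_iff_point_values\<close>). All estimates on functions thereby become statements about
  nets of real numbers.
\<close>

section \<open>Nets of real numbers\<close>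

lemma eventually_unit_interval: "\<forall>\<^sub>F \<epsilon>::real in at_right 0. \<epsilon> \<in> {0<..1}"
  using eventually_at_right_real[of 0 "1::real"] by (auto elim: eventually_mono)

lemma moderate_dominated:
  assumes "moderate y" "\<forall>\<^sub>F \<epsilon> in at_right 0. \<bar>x \<epsilon>\<bar> \<le> \<bar>y \<epsilon>\<bar>"
  shows "moderate x"
proof -
  have "x \<in> O[at_right 0](y)"
    using assms(2) by (intro bigoI[of _ 1]) simp
  then show ?thesis
    using assms(1) unfolding moderate_def by (blast intro: landau_o.big_trans)
qed

lemma negligible_net_dominated:
  assumes "negligible_net y" "\<forall>\<^sub>F \<epsilon> in at_right 0. \<bar>x \<epsilon>\<bar> \<le> \<bar>y \<epsilon>\<bar>"
  shows "negligible_net x"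
proof -
  have "x \<in> O[at_right 0](y)"
    using assms(2) by (intro bigoI[of _ 1]) simp
  then show ?thesis
    using assms(1) unfolding negligible_net_def by (blast intro: landau_o.big_trans)
qed

lemma negligible_net_cong:
  assumes "\<forall>\<^sub>F \<epsilon> in at_right 0. x \<epsilon> = y \<epsilon>"
  shows "negligible_net x \<longleftrightarrow> negligible_net y"
proof
  show "negligible_net y" if "negligible_net x"
    using that by (rule negligible_net_dominated) (use assms in \<open>auto elim: eventually_mono\<close>)
  show "negligible_net x" if "negligible_net y"
    using that by (rule negligible_net_dominated) (use assms in \<open>auto elim: eventually_mono\<close>)
qed

lemma moderate_sum:
  "finite A \<Longrightarrow> (\<And>i. i \<in> A \<Longrightarrow> moderate (x i)) \<Longrightarrow> moderate (\<lambda>\<epsilon>. \<Sum>i\<in>A. x i \<epsilon>)"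
  by (induction rule: finite_induct) (auto intro: moderate_add moderate_const)

lemma negligible_net_sum:
  "finite A \<Longrightarrow> (\<And>i. i \<in> A \<Longrightarrow> negligible_net (x i)) \<Longrightarrow> negligible_net (\<lambda>\<epsilon>. \<Sum>i\<in>A. x i \<epsilon>)"
  by (induction rule: finite_induct) (auto intro: negligible_net_add negligible_net_zero)

lemma negligible_net_less:
  assumes "negligible_net x" "0 < c"
  shows "\<forall>\<^sub>F \<epsilon> in at_right 0. \<bar>x \<epsilon>\<bar> < c"
proof -
  have "x \<in> O[at_right 0](\<lambda>\<epsilon>. \<epsilon> ^ 1)"
    using assms(1) unfolding negligible_net_def by blast
  then obtain C where C: "\<forall>\<^sub>F \<epsilon> in at_right 0. norm (x \<epsilon>) \<le> C * norm (\<epsilon> ^ 1)"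
    unfolding bigo_def by blast
  have "((\<lambda>\<epsilon>::real. C * norm (\<epsilon> ^ 1)) \<longlongrightarrow> C * norm ((0::real) ^ 1)) (at_right 0)"
    by (intro tendsto_intros)
  then have "\<forall>\<^sub>F \<epsilon>::real in at_right 0. C * norm (\<epsilon> ^ 1) < c"
    using assms(2) by (intro order_tendstoD) auto
  with C show ?thesis
    by eventually_elim simp
qed

lemma GenReal_cong:
  assumes "moderate x" "\<forall>\<epsilon>\<in>{0<..1}. y \<epsilon> = x \<epsilon>"
  shows "GenReal y = GenReal x"
proof -
  have eq: "\<forall>\<^sub>F \<epsilon> in at_right 0. y \<epsilon> = x \<epsilon>"
    using eventually_unit_interval by eventually_elim (rule assms(2)[rule_format])
  have "moderate y"
    using assms(1) by (rule moderate_dominated) (use eq in \<open>auto elim: eventually_mono\<close>)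
  moreover have "negligible_net (\<lambda>\<epsilon>. y \<epsilon> - x \<epsilon>) \<longleftrightarrow> negligible_net (\<lambda>_. 0)"
    by (rule negligible_net_cong) (use eq in \<open>auto elim: eventually_mono\<close>)
  ultimately show ?thesis
    using assms(1) by (simp add: GenReal_eq_iff negligible_net_zero)
qed

lemma GenReal_diff:
  assumes "moderate x" "moderate y"
  shows "GenReal x - GenReal y = GenReal (\<lambda>\<epsilon>. x \<epsilon> - y \<epsilon>)"
proof -
  have "moderate (\<lambda>\<epsilon>. x \<epsilon> - y \<epsilon>)"
    using moderate_add[OF assms(1) moderate_uminus[OF assms(2)]] by simp
  from GenReal_add[OF this assms(2)] have "GenReal (\<lambda>\<epsilon>. x \<epsilon> - y \<epsilon>) + GenReal y = GenReal x"
    by simp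
  then show ?thesis
    by (simp add: algebra_simps)
qed

lemma GenReal_sum:
  assumes "finite A" "\<And>i. i \<in> A \<Longrightarrow> moderate (x i)"
  shows "(\<Sum>i\<in>A. GenReal (x i)) = GenReal (\<lambda>\<epsilon>. \<Sum>i\<in>A. x i \<epsilon>)"
  using assms
  by (induction rule: finite_induct) (simp_all add: GenReal_zero GenReal_add moderate_sum)

lemma GenReal_one: "1 = GenReal (\<lambda>_. 1)"
  by (simp add: one_gen_real_def)

lemma GenReal_const_nonneg: "0 \<le> c \<Longrightarrow> 0 \<le> GenReal (\<lambda>_. c)"
  unfolding less_eq_gen_real_def gen_nonneg_def
  by (auto intro!: exI[of _ "\<lambda>_. c"] simp: moderate_const)

lemma GenReal_cases:
  obtains x where "moderate x" "a = GenReal x"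
proof
  show "moderate (rep_gen_real a)"
    using Quotient_rep_reflp[OF Quotient_gen_real, of a] by (simp add: gen_real_rel_refl)
  show "a = GenReal (rep_gen_real a)"
    by (simp add: Quotient_abs_rep[OF Quotient_gen_real])
qed

section \<open>Positive definite matrices over the generalized numbers\<close>

lemma quadratic_form_scale:
  fixes A :: "'a::comm_ring_1 ^ 'n ^ 'n"
  shows "scalar_product (c *s \<xi>) (A *v (c *s \<xi>)) = c * c * scalar_product \<xi> (A *v \<xi>)"
  by (simp add: scalar_product_def matrix_vector_mult_def sum_distrib_left mult_ac)

text \<open>
  From \<open>c Z = 0\<close> one gets \<open>c = c Z\<^sup>T Z = 0\<close>.
\<close>

lemma unit_vector_free:
  fixes Z :: "gen_real ^ 'n"
  assumes "scalar_product Z Z = 1"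
  shows "free_vector Z"
proof -
  have "Z \<noteq> 0"
    using assms by (auto simp: scalar_product_def)
  moreover have "c = 0" if "c *s Z = 0" for c
  proof -
    have "c = c * scalar_product Z Z"
      by (simp add: assms)
    also have "\<dots> = scalar_product (c *s Z) Z"
      by (simp add: scalar_product_def sum_distrib_left mult_ac)
    also have "\<dots> = 0"
      by (simp add: that scalar_product_def)
    finally show ?thesis .
  qed
  ultimately show ?thesis
    by (auto simp: free_vector_def)
qed

text \<open>
  A substitute for dividing \<open>\<xi>\<close> by its norm, which is impossible in general because the norm can
  be a zero divisor. Here \<open>e\<close> is the idempotent given by the indicator function of a set \<open>S\<close> of
  indices, \<open>s\<close> is the reciprocal of the norm on \<open>S\<close> and zero elsewhere, and \<open>Z\<close> is the
  normalized vector on \<open>S\<close>. The set is chosen such that the norm exceeds a power of \<open>\<epsilon>\<close> on it,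
  which makes \<open>s\<close> moderate; it accumulates at 0, which makes \<open>e\<close> nonzero.
\<close>

lemma nonzero_vector_polar_part:
  fixes \<xi> :: "gen_real ^ 'n"
  assumes "\<xi> \<noteq> 0"
  obtains e s Z where "e \<noteq> 0" "e * e = e" "scalar_product Z Z = 1" "e *s Z = s *s \<xi>"
proof -
  have "\<exists>x. moderate x \<and> \<xi> $ i = GenReal x" for i
    by (metis GenReal_cases)
  then obtain g where g: "\<And>i. moderate (g i)" "\<And>i. \<xi> $ i = GenReal (g i)"
    by metis
  define h where "h \<epsilon> = (\<chi> i. g i \<epsilon>)" for \<epsilon>
  obtain i0 where "\<xi> $ i0 \<noteq> 0"
    using assms by (auto simp: vec_eq_iff)
  then have "\<not> negligible_net (g i0)"
    using g(2)[of i0] GenReal_eq_iff[OF g(1)[of i0] moderate_const[of 0]] by (auto simp: GenReal_zero)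
  then obtain m where m: "g i0 \<notin> O[at_right 0](\<lambda>\<epsilon>. \<epsilon> ^ m)"
    unfolding negligible_net_def by blast
  \<comment> \<open>A component that is not \<open>O(\<epsilon>\<^sup>m)\<close> forces the norm above \<open>\<epsilon>\<^sup>m\<close> arbitrarily close to 0.\<close>
  define S where "S = {\<epsilon>. \<bar>\<epsilon> ^ m\<bar> < norm (h \<epsilon>)}"
  have S_frequent: "\<not> (\<forall>\<^sub>F \<epsilon> in at_right 0. \<epsilon> \<notin> S)"
  proof
    assume "\<forall>\<^sub>F \<epsilon> in at_right 0. \<epsilon> \<notin> S"
    then have "\<forall>\<^sub>F \<epsilon> in at_right 0. norm (g i0 \<epsilon>) \<le> 1 * norm (\<epsilon> ^ m)"
    proof eventually_elim
      case (elim \<epsilon>)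
      have "norm (g i0 \<epsilon>) \<le> norm (h \<epsilon>)"
        using component_le_norm_cart[of "h \<epsilon>" i0] by (simp add: h_def)
      with elim show ?case
        by (simp add: S_def)
    qed
    with m show False
      by (blast intro: bigoI)
  qed
  have h_pos: "0 < norm (h \<epsilon>)" if "\<epsilon> \<in> S" for \<epsilon>
    using that order_le_less_trans[OF abs_ge_zero] unfolding S_def by blast
  define z where "z \<epsilon> = (if \<epsilon> \<in> S then h \<epsilon> /\<^sub>R norm (h \<epsilon>) else axis i0 1)" for \<epsilon>
  have z_norm: "norm (z \<epsilon>) = 1" for \<epsilon>
    using h_pos[of \<epsilon>] by (auto simp: z_def)
  have z_mod: "moderate (\<lambda>\<epsilon>. z \<epsilon> $ i)" for i
    using component_le_norm_cart[of "z _" i] z_norm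
    by (intro moderate_dominated[OF moderate_const[of 1]]) simp
  define s where "s \<epsilon> = (if \<epsilon> \<in> S then 1 / norm (h \<epsilon>) else 0)" for \<epsilon>
  have "moderate (\<lambda>\<epsilon>. 1 / \<epsilon> ^ m)"
    unfolding moderate_def by (rule exI[of _ m]) simp
  then have s_mod: "moderate s"
  proof (rule moderate_dominated)
    show "\<forall>\<^sub>F \<epsilon> in at_right 0. \<bar>s \<epsilon>\<bar> \<le> \<bar>1 / \<epsilon> ^ m\<bar>"
      using eventually_unit_interval
    proof eventually_elim
      case (elim \<epsilon>)
      then have "0 < \<epsilon> ^ m"
        by simp
      then show ?case
        by (auto simp: s_def S_def intro!: frac_le)
    qed
  qed
  have e_mod: "moderate (indicator S)"
    by (rule moderate_dominated[OF moderate_const[of 1]]) (simp add: indicator_def)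
  show thesis
  proof
    show "GenReal (indicator S) \<noteq> 0"
    proof
      assume "GenReal (indicator S) = 0"
      then have "negligible_net (indicator S)"
        using GenReal_eq_iff[OF e_mod moderate_const[of 0]] by (simp add: GenReal_zero)
      from negligible_net_less[OF this, of 1] have "\<forall>\<^sub>F \<epsilon> in at_right 0. \<epsilon> \<notin> S"
        by (auto elim!: eventually_mono simp: indicator_def split: if_splits)
      with S_frequent show False ..
    qed
    have "(\<lambda>\<epsilon>. indicator S \<epsilon> * indicator S \<epsilon>) = (indicator S :: real \<Rightarrow> real)"
      by (auto simp: indicator_def)
    then show "GenReal (indicator S) * GenReal (indicator S) = GenReal (indicator S)"
      by (simp add: GenReal_mult e_mod)
    have "(\<lambda>\<epsilon>. \<Sum>i\<in>UNIV. z \<epsilon> $ i * z \<epsilon> $ i) = (\<lambda>_. 1)"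
      using z_norm by (auto simp: norm_eq_1 inner_vec_def)
    then show "scalar_product (\<chi> i. GenReal (\<lambda>\<epsilon>. z \<epsilon> $ i)) (\<chi> i. GenReal (\<lambda>\<epsilon>. z \<epsilon> $ i)) = 1"
      by (simp add: scalar_product_def GenReal_mult GenReal_sum moderate_mult z_mod GenReal_one)
    have "(\<lambda>\<epsilon>. indicator S \<epsilon> * z \<epsilon> $ i) = (\<lambda>\<epsilon>. s \<epsilon> * g i \<epsilon>)" for i
      by (auto simp: z_def s_def h_def indicator_def field_simps)
    then show "GenReal (indicator S) *s (\<chi> i. GenReal (\<lambda>\<epsilon>. z \<epsilon> $ i)) = GenReal s *s \<xi>"
      by (simp add: vec_eq_iff GenReal_mult e_mod z_mod s_mod g)
  qed
qed

text \<open>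
  With \<open>q\<close> the quadratic form of \<open>A\<close>, the identity \<open>e Z = s \<xi>\<close> gives
  \<open>e q(Z) = e\<^sup>2 q(Z) = s\<^sup>2 q(\<xi>) = 0\<close>, while \<open>q(Z)\<close> is invertible because \<open>Z\<close> is free. Hence
  \<open>e = 0\<close>, contrary to the choice of \<open>e\<close>.
\<close>

lemma pos_definite_quadratic_form_eq_0:
  assumes "pos_definite A" "scalar_product \<xi> (A *v \<xi>) = 0"
  shows "\<xi> = 0"
proof (rule ccontr)
  assume "\<xi> \<noteq> 0"
  then obtain e s Z where e: "e \<noteq> 0" "e * e = e" and Z: "scalar_product Z Z = 1"
    and eZ: "e *s Z = s *s \<xi>"
    by (rule nonzero_vector_polar_part)
  have "strictly_positive (scalar_product Z (A *v Z))"
    using assms(1) unit_vector_free[OF Z] by (simp add: pos_definite_def)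
  then obtain d where d: "1 = scalar_product Z (A *v Z) * d"
    unfolding strictly_positive_def by blast
  have "e = e * e * scalar_product Z (A *v Z) * d"
    using d e(2) by (simp add: mult.assoc)
  also have "\<dots> = s * s * scalar_product \<xi> (A *v \<xi>) * d"
    using eZ by (metis quadratic_form_scale)
  finally show False
    using e(1) assms(2) by simp
qed

section \<open>Smooth functions\<close>

lemma iter_partial_Nil: "iter_partial [] f = f"
  by (simp add: iter_partial_def)

lemma iter_partial_Cons: "iter_partial (i # is) f = partial_deriv i (iter_partial is f)"
  by (simp add: iter_partial_def)

lemma iter_partial_snoc: "iter_partial (is @ [i]) f = iter_partial is (partial_deriv i f)"
  by (simp add: iter_partial_def)

lemma smooth_on_partial_deriv: "smooth_on \<Omega> f \<Longrightarrow> smooth_on \<Omega> (partial_deriv i f)"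
  unfolding smooth_on_def iter_partial_snoc[symmetric] by blast

lemma smooth_on_iter_partial_differentiable:
  assumes "open \<Omega>" "smooth_on \<Omega> f" "x \<in> \<Omega>"
  shows "iter_partial is f differentiable at x"
  using assms(2,3) at_within_open[OF assms(3,1)] unfolding smooth_on_def differentiable_on_def
  by fastforce

lemma smooth_on_continuous_iter_partial:
  "smooth_on \<Omega> f \<Longrightarrow> K \<subseteq> \<Omega> \<Longrightarrow> continuous_on K (iter_partial is f)"
  unfolding smooth_on_def
  by (rule continuous_on_subset[OF differentiable_imp_continuous_on]) blast+

lemma partial_deriv_eq:
  "(f has_derivative f') (at x) \<Longrightarrow> partial_deriv i f x = f' (axis i 1)"
  using frechet_derivative_at[of f f' x] by (simp add: partial_deriv_def)

text \<open>
  The two claims belong together: \<open>iter_partial is (\<lambda>x. f x - g x)\<close> is known only on \<open>\<Omega>\<close>, and it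
  is the openness of \<open>\<Omega>\<close> that allows this equality to be differentiated once more.
\<close>

lemma iter_partial_diff:
  assumes "open \<Omega>" "smooth_on \<Omega> f" "smooth_on \<Omega> g" "x \<in> \<Omega>"
  shows "iter_partial is (\<lambda>x. f x - g x) x = iter_partial is f x - iter_partial is g x"
    and "iter_partial is (\<lambda>x. f x - g x) differentiable at x"
proof -
  let ?D = "\<lambda>is x. iter_partial is f x - iter_partial is g x"
  have D: "(?D is has_derivative
      (\<lambda>h. frechet_derivative (iter_partial is f) (at y) h - frechet_derivative (iter_partial is g) (at y) h)) (at y)"
    if "y \<in> \<Omega>" for "is" y
    using assms that smooth_on_iter_partial_differentiable
    by (intro has_derivative_diff) (auto simp flip: frechet_derivative_works)
  have "\<forall>y\<in>\<Omega>. iter_partial is (\<lambda>x. f x - g x) y = ?D is y"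
  proof (induction "is")
    case Nil
    show ?case
      by (simp add: iter_partial_Nil)
  next
    case (Cons i "is")
    show ?case
    proof
      fix y
      assume y: "y \<in> \<Omega>"
      have "(iter_partial is (\<lambda>x. f x - g x) has_derivative
        (\<lambda>h. frechet_derivative (iter_partial is f) (at y) h - frechet_derivative (iter_partial is g) (at y) h)) (at y)"
        by (rule has_derivative_transform_within_open[OF D[OF y] assms(1) y]) (use Cons.IH in simp)
      then show "iter_partial (i # is) (\<lambda>x. f x - g x) y = ?D (i # is) y"
        by (simp add: iter_partial_Cons partial_deriv_eq) (simp add: partial_deriv_def)
    qed
  qed
  note eq = this
  then show "iter_partial is (\<lambda>x. f x - g x) x = ?D is x"
    using assms(4) by blast
  have "(iter_partial is (\<lambda>x. f x - g x) has_derivative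
      (\<lambda>h. frechet_derivative (iter_partial is f) (at x) h - frechet_derivative (iter_partial is g) (at x) h)) (at x)"
    by (rule has_derivative_transform_within_open[OF D[OF assms(4)] assms(1,4)]) (use eq in simp)
  then show "iter_partial is (\<lambda>x. f x - g x) differentiable at x"
    by (rule differentiableI)
qed

lemma smooth_on_diff:
  assumes "open \<Omega>" "smooth_on \<Omega> f" "smooth_on \<Omega> g"
  shows "smooth_on \<Omega> (\<lambda>x. f x - g x)"
  unfolding smooth_on_def differentiable_on_def
  using iter_partial_diff(2)[OF assms] by (blast intro: differentiable_at_withinI)

lemma smooth_on_line_derivative:
  fixes f :: "real ^ 'n \<Rightarrow> real"
  assumes "open \<Omega>" "smooth_on \<Omega> f" "a + t *\<^sub>R h \<in> \<Omega>"
  shows "((\<lambda>t. f (a + t *\<^sub>R h)) has_real_derivative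
    (\<Sum>i\<in>UNIV. h $ i * partial_deriv i f (a + t *\<^sub>R h))) (at t)"
proof -
  let ?D = "frechet_derivative f (at (a + t *\<^sub>R h))"
  have D: "(f has_derivative ?D) (at (a + t *\<^sub>R h))"
    using smooth_on_iter_partial_differentiable[OF assms, of "[]"]
    by (simp add: iter_partial_Nil frechet_derivative_works)
  then have lin: "linear ?D"
    by (rule has_derivative_linear)
  have "((\<lambda>t. a + t *\<^sub>R h) has_derivative (\<lambda>s. s *\<^sub>R h)) (at t)"
    by (auto intro!: derivative_eq_intros)
  from has_derivative_compose[OF this D]
  have "((\<lambda>t. f (a + t *\<^sub>R h)) has_derivative (\<lambda>s. ?D (s *\<^sub>R h))) (at t)" .
  moreover have "?D (s *\<^sub>R h) = (\<Sum>i\<in>UNIV. h $ i * partial_deriv i f (a + t *\<^sub>R h)) * s" for s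
  proof -
    have "h = (\<Sum>i\<in>UNIV. h $ i *\<^sub>R axis i 1)"
      using basis_expansion[of h] by (simp add: scalar_mult_eq_scaleR)
    then have "?D h = ?D (\<Sum>i\<in>UNIV. h $ i *\<^sub>R axis i 1)"
      by (rule arg_cong)
    also have "\<dots> = (\<Sum>i\<in>UNIV. h $ i * ?D (axis i 1))"
      by (simp add: linear_sum[OF lin] linear_scale[OF lin])
    finally show ?thesis
      by (simp add: linear_scale[OF lin] partial_deriv_def mult.commute)
  qed
  ultimately show ?thesis
    by (simp add: has_field_derivative_def)
qed

lemma mean_value_segment:
  fixes f :: "real ^ 'n \<Rightarrow> real"
  assumes "open \<Omega>" "smooth_on \<Omega> f" "closed_segment a (a + h) \<subseteq> \<Omega>"
  obtains t where "0 \<le> t" "t \<le> 1"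
    "f (a + h) - f a = (\<Sum>i\<in>UNIV. h $ i * partial_deriv i f (a + t *\<^sub>R h))"
proof -
  have seg: "a + t *\<^sub>R h \<in> \<Omega>" if "0 \<le> t" "t \<le> 1" for t
    using assms(3) that by (force simp: closed_segment_def algebra_simps)
  have "((\<lambda>t. f (a + t *\<^sub>R h)) has_real_derivative
      (\<Sum>i\<in>UNIV. h $ i * partial_deriv i f (a + t *\<^sub>R h))) (at t)" if "0 \<le> t" "t \<le> 1" for t
    by (rule smooth_on_line_derivative[OF assms(1,2) seg[OF that]])
  from MVT2[OF zero_less_one this] obtain t where "0 < t" "t < 1"
    "f (a + 1 *\<^sub>R h) - f (a + 0 *\<^sub>R h) =
      (1 - 0) * (\<Sum>i\<in>UNIV. h $ i * partial_deriv i f (a + t *\<^sub>R h))"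
    by blast
  then show thesis
    by (intro that[of t]) auto
qed

text \<open>
  Maclaurin's formula of order 2 for \<open>t \<mapsto> f (a + t h)\<close>, whose second derivative is the quadratic
  form of the Hessian matrix, written with the same order of partial derivatives as in
  \<open>gen_hessian\<close>.
\<close>

lemma second_order_Taylor_segment:
  fixes f :: "real ^ 'n \<Rightarrow> real"
  assumes "open \<Omega>" "smooth_on \<Omega> f" "closed_segment a (a + h) \<subseteq> \<Omega>"
  obtains t where "0 \<le> t" "t \<le> 1"
    "f (a + h) - f a = (\<Sum>i\<in>UNIV. h $ i * partial_deriv i f a) +
      1 / 2 * (\<Sum>i\<in>UNIV. h $ i * (\<Sum>j\<in>UNIV. partial_deriv i (partial_deriv j f) (a + t *\<^sub>R h) * h $ j))"
proof -
  have seg: "a + t *\<^sub>R h \<in> \<Omega>" if "0 \<le> t" "t \<le> 1" for t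
    using assms(3) that by (force simp: closed_segment_def algebra_simps)
  define D1 where "D1 t = (\<Sum>i\<in>UNIV. h $ i * partial_deriv i f (a + t *\<^sub>R h))" for t
  define D2 where "D2 t = (\<Sum>j\<in>UNIV. h $ j * (\<Sum>i\<in>UNIV. h $ i * partial_deriv i (partial_deriv j f) (a + t *\<^sub>R h)))" for t
  \<comment> \<open>The derivatives of \<open>f\<close> along the line, in the indexed form that the Maclaurin formula takes.\<close>
  define diff where "diff m = (if m = 0 then (\<lambda>t. f (a + t *\<^sub>R h)) else if m = 1 then D1 else D2)" for m :: nat
  have d1: "((\<lambda>t. f (a + t *\<^sub>R h)) has_real_derivative D1 t) (at t)" if "0 \<le> t" "t \<le> 1" for t
    unfolding D1_def by (rule smooth_on_line_derivative[OF assms(1,2) seg[OF that]])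
  have d2: "(D1 has_real_derivative D2 t) (at t)" if "0 \<le> t" "t \<le> 1" for t
    unfolding D1_def[abs_def] D2_def
    by (rule DERIV_sum, rule DERIV_cmult,
        rule smooth_on_line_derivative[OF assms(1) smooth_on_partial_deriv[OF assms(2)] seg[OF that]])
  have "\<forall>m t. m < 2 \<and> 0 \<le> t \<and> t \<le> 1 \<longrightarrow> (diff m has_real_derivative diff (Suc m) t) (at t)"
    using d1 d2 by (auto simp: diff_def less_2_cases_iff)
  from Maclaurin[of 1 2 diff "diff 0", OF zero_less_one zero_less_numeral refl this]
  obtain t where t: "0 < t" "t < 1"
    "diff 0 1 = (\<Sum>m<2. (diff m 0 / fact m) * 1 ^ m) + diff 2 t / fact 2 * 1 ^ 2"
    by blast
  then have "f (a + h) - f a = D1 0 + 1 / 2 * D2 t"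
    by (simp add: diff_def numeral_2_eq_2)
  moreover have "D2 t = (\<Sum>i\<in>UNIV. h $ i * (\<Sum>j\<in>UNIV. partial_deriv i (partial_deriv j f) (a + t *\<^sub>R h) * h $ j))"
    unfolding D2_def sum_distrib_left by (rule trans[OF sum.swap]) (simp add: mult_ac)
  ultimately show thesis
    using t(1,2) by (intro that[of t]) (auto simp: D1_def)
qed

section \<open>The Colombeau algebra\<close>

text \<open>
  For each \<open>\<epsilon>\<close> the supremum over \<open>K\<close> is the value at some \<open>w\<^sub>\<epsilon> \<in> K\<close>, and \<open>w\<close> is one of the nets
  on the right-hand side; conversely every such net is dominated by the supremum. The predicate
  \<open>P\<close> stands for moderateness or negligibility.
\<close>

lemma sup_net_iff:
  fixes \<phi> :: "real \<Rightarrow> real ^ 'n \<Rightarrow> real" and P :: "(real \<Rightarrow> real) \<Rightarrow> bool"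
  assumes dominated: "\<And>x y. P y \<Longrightarrow> \<forall>\<^sub>F \<epsilon> in at_right 0. \<bar>x \<epsilon>\<bar> \<le> \<bar>y \<epsilon>\<bar> \<Longrightarrow> P x"
    and K: "compact K" "K \<noteq> {}" and cont: "\<And>\<epsilon>. \<epsilon> \<in> {0<..1} \<Longrightarrow> continuous_on K (\<phi> \<epsilon>)"
  shows "P (\<lambda>\<epsilon>. SUP x\<in>K. \<bar>\<phi> \<epsilon> x\<bar>) \<longleftrightarrow>
    (\<forall>z. (\<forall>\<^sub>F \<epsilon> in at_right 0. z \<epsilon> \<in> K) \<longrightarrow> P (\<lambda>\<epsilon>. \<phi> \<epsilon> (z \<epsilon>)))"
proof -
  have "\<exists>x\<in>K. \<forall>y\<in>K. \<bar>\<phi> \<epsilon> y\<bar> \<le> \<bar>\<phi> \<epsilon> x\<bar>" if "\<epsilon> \<in> {0<..1}" for \<epsilon>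
    using K cont[OF that] by (intro continuous_attains_sup continuous_on_rabs)
  then obtain w where w: "\<And>\<epsilon>. \<epsilon> \<in> {0<..1} \<Longrightarrow> w \<epsilon> \<in> K"
    "\<And>\<epsilon> y. \<epsilon> \<in> {0<..1} \<Longrightarrow> y \<in> K \<Longrightarrow> \<bar>\<phi> \<epsilon> y\<bar> \<le> \<bar>\<phi> \<epsilon> (w \<epsilon>)\<bar>"
    by metis
  have sup: "(SUP x\<in>K. \<bar>\<phi> \<epsilon> x\<bar>) = \<bar>\<phi> \<epsilon> (w \<epsilon>)\<bar>" if "\<epsilon> \<in> {0<..1}" for \<epsilon>
    using w that by (intro cSup_eq_maximum) auto
  show ?thesis
  proof (intro iffI allI impI)
    fix z :: "real \<Rightarrow> real ^ 'n"
    assume P: "P (\<lambda>\<epsilon>. SUP x\<in>K. \<bar>\<phi> \<epsilon> x\<bar>)" and z: "\<forall>\<^sub>F \<epsilon> in at_right 0. z \<epsilon> \<in> K"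
    show "P (\<lambda>\<epsilon>. \<phi> \<epsilon> (z \<epsilon>))"
      using P by (rule dominated) (use z eventually_unit_interval in eventually_elim, simp add: sup w)
  next
    assume P: "\<forall>z :: real \<Rightarrow> real ^ 'n. (\<forall>\<^sub>F \<epsilon> in at_right 0. z \<epsilon> \<in> K) \<longrightarrow> P (\<lambda>\<epsilon>. \<phi> \<epsilon> (z \<epsilon>))"
    have "\<forall>\<^sub>F \<epsilon> in at_right 0. w \<epsilon> \<in> K"
      using eventually_unit_interval by eventually_elim (rule w)
    with P have "P (\<lambda>\<epsilon>. \<phi> \<epsilon> (w \<epsilon>))"
      by blast
    then show "P (\<lambda>\<epsilon>. SUP x\<in>K. \<bar>\<phi> \<epsilon> x\<bar>)"
      by (rule dominated) (use eventually_unit_interval in eventually_elim, simp add: sup)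
  qed
qed

lemma eventually_mem_nonempty:
  assumes "\<forall>\<^sub>F \<epsilon> in at_right (0::real). z \<epsilon> \<in> K"
  shows "K \<noteq> {}"
  using eventually_happens[OF assms] by auto

lemma seminorm_bound_iff_point_values:
  fixes u :: "real \<Rightarrow> real ^ 'n \<Rightarrow> real" and P :: "(real \<Rightarrow> real) \<Rightarrow> bool"
  assumes dominated: "\<And>x y. P y \<Longrightarrow> \<forall>\<^sub>F \<epsilon> in at_right 0. \<bar>x \<epsilon>\<bar> \<le> \<bar>y \<epsilon>\<bar> \<Longrightarrow> P x"
    and smooth: "\<forall>\<epsilon>\<in>{0<..1}. smooth_on \<Omega> (u \<epsilon>)"
  shows "(\<forall>K is. compact K \<and> K \<noteq> {} \<and> K \<subseteq> \<Omega> \<longrightarrow> P (\<lambda>\<epsilon>. SUP x\<in>K. \<bar>iter_partial is (u \<epsilon>) x\<bar>)) \<longleftrightarrow>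
    (\<forall>K is z. compact K \<and> K \<subseteq> \<Omega> \<and> (\<forall>\<^sub>F \<epsilon> in at_right 0. z \<epsilon> \<in> K) \<longrightarrow>
      P (\<lambda>\<epsilon>. iter_partial is (u \<epsilon>) (z \<epsilon>)))"
proof -
  have "(compact K \<and> K \<noteq> {} \<and> K \<subseteq> \<Omega> \<longrightarrow> P (\<lambda>\<epsilon>. SUP x\<in>K. \<bar>iter_partial is (u \<epsilon>) x\<bar>)) \<longleftrightarrow>
      (\<forall>z. compact K \<and> K \<subseteq> \<Omega> \<and> (\<forall>\<^sub>F \<epsilon> in at_right 0. z \<epsilon> \<in> K) \<longrightarrow>
        P (\<lambda>\<epsilon>. iter_partial is (u \<epsilon>) (z \<epsilon>)))" for K "is"
  proof (cases "compact K \<and> K \<noteq> {} \<and> K \<subseteq> \<Omega>")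
    case K: True
    have "P (\<lambda>\<epsilon>. SUP x\<in>K. \<bar>iter_partial is (u \<epsilon>) x\<bar>) \<longleftrightarrow>
      (\<forall>z. (\<forall>\<^sub>F \<epsilon> in at_right 0. z \<epsilon> \<in> K) \<longrightarrow> P (\<lambda>\<epsilon>. iter_partial is (u \<epsilon>) (z \<epsilon>)))"
      by (rule sup_net_iff[of P, OF dominated])
        (use K smooth in \<open>auto intro: smooth_on_continuous_iter_partial\<close>)
    then show ?thesis
      using K by simp
  next
    case False
    then show ?thesis
      using eventually_mem_nonempty by blast
  qed
  then show ?thesis
    by simp
qed

text \<open>
  The form in which membership is used from here on: sums, differences and derivatives of nets of
  functions can be handled pointwise along a net \<open>z\<close>.
\<close>

lemma moderate_functions_iff:
  "u \<in> moderate_functions \<Omega> \<longleftrightarrow> (\<forall>\<epsilon>\<in>{0<..1}. smooth_on \<Omega> (u \<epsilon>)) \<and>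
     (\<forall>K is z. compact K \<and> K \<subseteq> \<Omega> \<and> (\<forall>\<^sub>F \<epsilon> in at_right 0. z \<epsilon> \<in> K) \<longrightarrow>
        moderate (\<lambda>\<epsilon>. iter_partial is (u \<epsilon>) (z \<epsilon>)))"
  unfolding moderate_functions_def moderate_def[symmetric] mem_Collect_eq
  by (rule conj_cong[OF refl]) (rule seminorm_bound_iff_point_values[OF moderate_dominated])

lemma negligible_functions_iff:
  "u \<in> negligible_functions \<Omega> \<longleftrightarrow> (\<forall>\<epsilon>\<in>{0<..1}. smooth_on \<Omega> (u \<epsilon>)) \<and>
     (\<forall>K is z. compact K \<and> K \<subseteq> \<Omega> \<and> (\<forall>\<^sub>F \<epsilon> in at_right 0. z \<epsilon> \<in> K) \<longrightarrow>
        negligible_net (\<lambda>\<epsilon>. iter_partial is (u \<epsilon>) (z \<epsilon>)))"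
  unfolding negligible_functions_def negligible_net_def[symmetric] mem_Collect_eq
  by (rule conj_cong[OF refl]) (rule seminorm_bound_iff_point_values[OF negligible_net_dominated])

lemma colombeau_rel_iff:
  assumes "open \<Omega>"
  shows "(u, v) \<in> colombeau_rel \<Omega> \<longleftrightarrow> u \<in> moderate_functions \<Omega> \<and> v \<in> moderate_functions \<Omega> \<and>
     (\<forall>K is z. compact K \<and> K \<subseteq> \<Omega> \<and> (\<forall>\<^sub>F \<epsilon> in at_right 0. z \<epsilon> \<in> K) \<longrightarrow>
        negligible_net (\<lambda>\<epsilon>. iter_partial is (u \<epsilon>) (z \<epsilon>) - iter_partial is (v \<epsilon>) (z \<epsilon>)))"
proof (cases "u \<in> moderate_functions \<Omega> \<and> v \<in> moderate_functions \<Omega>")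
  case True
  then have sm: "\<And>\<epsilon>. \<epsilon> \<in> {0<..1} \<Longrightarrow> smooth_on \<Omega> (u \<epsilon>)" "\<And>\<epsilon>. \<epsilon> \<in> {0<..1} \<Longrightarrow> smooth_on \<Omega> (v \<epsilon>)"
    by (auto simp: moderate_functions_def)
  have *: "\<forall>\<^sub>F \<epsilon> in at_right 0. iter_partial is (\<lambda>x. u \<epsilon> x - v \<epsilon> x) (z \<epsilon>) =
      iter_partial is (u \<epsilon>) (z \<epsilon>) - iter_partial is (v \<epsilon>) (z \<epsilon>)"
    if "K \<subseteq> \<Omega>" "\<forall>\<^sub>F \<epsilon> in at_right 0. z \<epsilon> \<in> K" for K "is" z
    using eventually_unit_interval that(2)
  proof eventually_elim
    case (elim \<epsilon>)
    then show ?case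
      using that(1) by (intro iter_partial_diff(1)[OF assms sm]) auto
  qed
  have eq: "(compact K \<and> K \<subseteq> \<Omega> \<and> (\<forall>\<^sub>F \<epsilon> in at_right 0. z \<epsilon> \<in> K) \<longrightarrow>
        negligible_net (\<lambda>\<epsilon>. iter_partial is (\<lambda>x. u \<epsilon> x - v \<epsilon> x) (z \<epsilon>))) \<longleftrightarrow>
      (compact K \<and> K \<subseteq> \<Omega> \<and> (\<forall>\<^sub>F \<epsilon> in at_right 0. z \<epsilon> \<in> K) \<longrightarrow>
        negligible_net (\<lambda>\<epsilon>. iter_partial is (u \<epsilon>) (z \<epsilon>) - iter_partial is (v \<epsilon>) (z \<epsilon>)))" for K "is" z
    by (rule imp_cong[OF refl], elim conjE) (rule negligible_net_cong[OF *])
  have "\<forall>\<epsilon>\<in>{0<..1}. smooth_on \<Omega> (\<lambda>x. u \<epsilon> x - v \<epsilon> x)"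
    using smooth_on_diff[OF assms sm] by blast
  then show ?thesis
    unfolding colombeau_rel_def mem_Collect_eq case_prod_conv negligible_functions_iff eq
    using True by blast
qed (auto simp: colombeau_rel_def)

lemma colombeau_rel_negligible:
  assumes "open \<Omega>" "(u, v) \<in> colombeau_rel \<Omega>"
    "compact K \<and> K \<subseteq> \<Omega> \<and> (\<forall>\<^sub>F \<epsilon> in at_right 0. z \<epsilon> \<in> K)"
  shows "negligible_net (\<lambda>\<epsilon>. iter_partial is (u \<epsilon>) (z \<epsilon>) - iter_partial is (v \<epsilon>) (z \<epsilon>))"
  using assms(2)[unfolded colombeau_rel_iff[OF assms(1)], THEN conjunct2, THEN conjunct2, rule_format, OF assms(3)] .

lemma equiv_colombeau_rel:
  assumes "open \<Omega>"
  shows "equiv (moderate_functions \<Omega>) (colombeau_rel \<Omega>)"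
proof (rule equivI)
  show "colombeau_rel \<Omega> \<subseteq> moderate_functions \<Omega> \<times> moderate_functions \<Omega>"
    by (auto simp: colombeau_rel_def)
  show "refl_on (moderate_functions \<Omega>) (colombeau_rel \<Omega>)"
    by (rule refl_onI) (simp add: colombeau_rel_iff[OF assms] negligible_net_zero)
  show "sym (colombeau_rel \<Omega>)"
  proof (rule symI)
    fix u v
    assume uv: "(u, v) \<in> colombeau_rel \<Omega>"
    then have mods: "u \<in> moderate_functions \<Omega>" "v \<in> moderate_functions \<Omega>"
      by (simp_all add: colombeau_rel_def)
    have "negligible_net (\<lambda>\<epsilon>. iter_partial is (v \<epsilon>) (z \<epsilon>) - iter_partial is (u \<epsilon>) (z \<epsilon>))"
      if "compact K \<and> K \<subseteq> \<Omega> \<and> (\<forall>\<^sub>F \<epsilon> in at_right 0. z \<epsilon> \<in> K)" for K "is" z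
      using negligible_net_uminus[OF colombeau_rel_negligible[OF assms uv that, of "is"]] by simp
    then show "(v, u) \<in> colombeau_rel \<Omega>"
      unfolding colombeau_rel_iff[OF assms] by (intro conjI mods allI impI)
  qed
  show "trans (colombeau_rel \<Omega>)"
  proof (rule transI)
    fix u v w
    assume uv: "(u, v) \<in> colombeau_rel \<Omega>" and vw: "(v, w) \<in> colombeau_rel \<Omega>"
    then have mods: "u \<in> moderate_functions \<Omega>" "w \<in> moderate_functions \<Omega>"
      by (simp_all add: colombeau_rel_def)
    have "negligible_net (\<lambda>\<epsilon>. iter_partial is (u \<epsilon>) (z \<epsilon>) - iter_partial is (w \<epsilon>) (z \<epsilon>))"
      if "compact K \<and> K \<subseteq> \<Omega> \<and> (\<forall>\<^sub>F \<epsilon> in at_right 0. z \<epsilon> \<in> K)" for K "is" z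
      using negligible_net_add[OF colombeau_rel_negligible[OF assms uv that, of "is"]
          colombeau_rel_negligible[OF assms vw that, of "is"]] by simp
    then show "(u, w) \<in> colombeau_rel \<Omega>"
      unfolding colombeau_rel_iff[OF assms] by (intro conjI mods allI impI)
  qed
qed

lemma moderate_functions_partial_deriv:
  assumes "f \<in> moderate_functions \<Omega>"
  shows "(\<lambda>\<epsilon>. partial_deriv i (f \<epsilon>)) \<in> moderate_functions \<Omega>"
  using assms unfolding moderate_functions_iff iter_partial_snoc[symmetric]
  by (blast intro: smooth_on_partial_deriv)

lemma colombeau_rel_partial_deriv:
  assumes "open \<Omega>" "(f, g) \<in> colombeau_rel \<Omega>"
  shows "((\<lambda>\<epsilon>. partial_deriv i (f \<epsilon>)), (\<lambda>\<epsilon>. partial_deriv i (g \<epsilon>))) \<in> colombeau_rel \<Omega>"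
  using assms(2) unfolding colombeau_rel_iff[OF assms(1)] iter_partial_snoc[symmetric]
  by (blast intro: moderate_functions_partial_deriv)

text \<open>
  \<open>colombeau_partial\<close> differentiates all representatives and saturates the result. As
  differentiation respects the equivalence, every representative contributes the same class.
\<close>

lemma colombeau_partial_class:
  assumes "open \<Omega>" "f \<in> moderate_functions \<Omega>"
  shows "colombeau_partial \<Omega> i (colombeau_rel \<Omega> `` {f}) =
    colombeau_rel \<Omega> `` {\<lambda>\<epsilon>. partial_deriv i (f \<epsilon>)}"
proof -
  note equiv = equiv_colombeau_rel[OF assms(1)]
  have "colombeau_partial \<Omega> i (colombeau_rel \<Omega> `` {f}) =
      (\<Union>g\<in>colombeau_rel \<Omega> `` {f}. colombeau_rel \<Omega> `` {\<lambda>\<epsilon>. partial_deriv i (g \<epsilon>)})"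
    unfolding colombeau_partial_def by blast
  also have "\<dots> = (\<Union>g\<in>colombeau_rel \<Omega> `` {f}. colombeau_rel \<Omega> `` {\<lambda>\<epsilon>. partial_deriv i (f \<epsilon>)})"
  proof (rule SUP_cong[OF refl])
    fix g
    assume "g \<in> colombeau_rel \<Omega> `` {f}"
    then have "(f, g) \<in> colombeau_rel \<Omega>"
      by simp
    from equiv_class_eq[OF equiv colombeau_rel_partial_deriv[OF assms(1) this]]
    show "colombeau_rel \<Omega> `` {\<lambda>\<epsilon>. partial_deriv i (g \<epsilon>)} =
        colombeau_rel \<Omega> `` {\<lambda>\<epsilon>. partial_deriv i (f \<epsilon>)}"
      by (rule sym)
  qed
  also have "\<dots> = colombeau_rel \<Omega> `` {\<lambda>\<epsilon>. partial_deriv i (f \<epsilon>)}"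
    using equiv_class_self[OF equiv assms(2)] by blast
  finally show ?thesis .
qed

section \<open>Generalized points and point values\<close>

lemma equiv_point_rel: "equiv (compact_nets \<Omega>) (point_rel \<Omega>)"
proof (rule equivI)
  show "point_rel \<Omega> \<subseteq> compact_nets \<Omega> \<times> compact_nets \<Omega>"
    by (auto simp: point_rel_def)
  show "refl_on (compact_nets \<Omega>) (point_rel \<Omega>)"
    by (rule refl_onI) (simp add: point_rel_def negligible_net_zero)
  show "sym (point_rel \<Omega>)"
    by (rule symI) (auto simp: point_rel_def norm_minus_commute)
  show "trans (point_rel \<Omega>)"
  proof (rule transI)
    fix x y z
    assume *: "(x, y) \<in> point_rel \<Omega>" "(y, z) \<in> point_rel \<Omega>"
    have "negligible_net (\<lambda>\<epsilon>. norm (x \<epsilon> - y \<epsilon>) + norm (y \<epsilon> - z \<epsilon>))"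
      using * by (intro negligible_net_add) (auto simp: point_rel_def)
    then have "negligible_net (\<lambda>\<epsilon>. norm (x \<epsilon> - z \<epsilon>))"
    proof (rule negligible_net_dominated)
      show "\<forall>\<^sub>F \<epsilon> in at_right 0. \<bar>norm (x \<epsilon> - z \<epsilon>)\<bar> \<le> \<bar>norm (x \<epsilon> - y \<epsilon>) + norm (y \<epsilon> - z \<epsilon>)\<bar>"
      proof (rule always_eventually, rule allI)
        fix \<epsilon>
        show "\<bar>norm (x \<epsilon> - z \<epsilon>)\<bar> \<le> \<bar>norm (x \<epsilon> - y \<epsilon>) + norm (y \<epsilon> - z \<epsilon>)\<bar>"
          using norm_triangle_ineq[of "x \<epsilon> - y \<epsilon>" "y \<epsilon> - z \<epsilon>"] by simp
      qed
    qed
    with * show "(x, z) \<in> point_rel \<Omega>"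
      by (auto simp: point_rel_def)
  qed
qed

lemma compact_nets_eventually:
  assumes "x \<in> compact_nets \<Omega>'" "\<Omega>' \<subseteq> \<Omega>"
  obtains K where "compact K" "K \<subseteq> \<Omega>" "\<forall>\<^sub>F \<epsilon> in at_right 0. x \<epsilon> \<in> K"
  using assms unfolding compact_nets_def by blast

lemma moderate_point_value:
  assumes "f \<in> moderate_functions \<Omega>" "x \<in> compact_nets \<Omega>'" "\<Omega>' \<subseteq> \<Omega>"
  shows "moderate (\<lambda>\<epsilon>. f \<epsilon> (x \<epsilon>))"
proof -
  obtain K where "compact K" "K \<subseteq> \<Omega>" "\<forall>\<^sub>F \<epsilon> in at_right 0. x \<epsilon> \<in> K"
    using assms(2,3) by (rule compact_nets_eventually)
  then have "moderate (\<lambda>\<epsilon>. iter_partial [] (f \<epsilon>) (x \<epsilon>))"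
    using assms(1) unfolding moderate_functions_iff by blast
  then show ?thesis
    by (simp add: iter_partial_Nil)
qed

text \<open>
  Generalized functions respect equivalence of generalized points. By the mean value theorem the
  difference is \<open>\<Sum>\<^sub>i h\<^sub>i \<partial>\<^sub>i f\<^sub>\<epsilon>(z\<^sub>\<epsilon>)\<close> with \<open>h\<close> negligible. The points \<open>z\<^sub>\<epsilon>\<close> lie between \<open>x\<^sub>\<epsilon>\<close> and
  \<open>y\<^sub>\<epsilon>\<close>, possibly outside the compact set containing \<open>x\<^sub>\<epsilon>\<close> (and outside \<open>\<Omega>'\<close>), but
  eventually in a compact neighbourhood of it inside \<open>\<Omega>\<close>; hence the partial derivatives are
  moderate along \<open>z\<close>.
\<close>

lemma negligible_point_value_diff:
  assumes "open \<Omega>" "f \<in> moderate_functions \<Omega>"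
    and x: "x \<in> compact_nets \<Omega>'" "\<Omega>' \<subseteq> \<Omega>" and xy: "negligible_net (\<lambda>\<epsilon>. norm (x \<epsilon> - y \<epsilon>))"
  shows "negligible_net (\<lambda>\<epsilon>. f \<epsilon> (x \<epsilon>) - f \<epsilon> (y \<epsilon>))"
proof -
  obtain K where K: "compact K" "K \<subseteq> \<Omega>" "\<forall>\<^sub>F \<epsilon> in at_right 0. x \<epsilon> \<in> K"
    using x by (rule compact_nets_eventually)
  obtain d where d: "0 < d" "(\<Union>k\<in>K. cball k d) \<subseteq> \<Omega>"
    using compact_subset_open_imp_cball_epsilon_subset[OF K(1) assms(1) K(2)] by metis
  define L where "L = (\<Union>k\<in>K. \<Union>v\<in>cball 0 d. {k + v})"
  have L: "compact L"
    unfolding L_def by (rule compact_sums'[OF K(1) compact_cball])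
  have L_mem: "z \<in> L" if "k \<in> K" "dist k z \<le> d" for k z
    unfolding L_def using that by (intro UN_I[of k] UN_I[of "z - k"]) (auto simp: dist_norm norm_minus_commute)
  have "L \<subseteq> \<Omega>"
    using d(2) by (force simp: L_def dist_norm)
  define h where "h \<epsilon> = x \<epsilon> - y \<epsilon>" for \<epsilon>
  \<comment> \<open>The indices at which the whole segment from \<open>y\<^sub>\<epsilon>\<close> to \<open>x\<^sub>\<epsilon>\<close> lies in \<open>L\<close>.\<close>
  define G where "G \<epsilon> \<longleftrightarrow> \<epsilon> \<in> {0<..1} \<and> x \<epsilon> \<in> K \<and> norm (h \<epsilon>) \<le> d" for \<epsilon>
  have "\<forall>\<^sub>F \<epsilon> in at_right 0. \<bar>norm (x \<epsilon> - y \<epsilon>)\<bar> < d"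
    using xy d(1) by (rule negligible_net_less)
  then have G_ev: "\<forall>\<^sub>F \<epsilon> in at_right 0. G \<epsilon>"
    using K(3) eventually_unit_interval by eventually_elim (simp add: G_def h_def)
  have near: "y \<epsilon> + t *\<^sub>R h \<epsilon> \<in> L" if "G \<epsilon>" "0 \<le> t" "t \<le> 1" for \<epsilon> t
  proof (rule L_mem)
    show "x \<epsilon> \<in> K"
      using that(1) by (simp add: G_def)
    have "dist (x \<epsilon>) (y \<epsilon> + t *\<^sub>R h \<epsilon>) = norm ((1 - t) *\<^sub>R h \<epsilon>)"
      by (simp add: dist_norm h_def algebra_simps)
    also have "\<dots> \<le> norm (h \<epsilon>)"
      using that(2,3) by (simp add: mult_left_le_one_le)
    finally show "dist (x \<epsilon>) (y \<epsilon> + t *\<^sub>R h \<epsilon>) \<le> d"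
      using that(1) by (simp add: G_def)
  qed
  have "\<exists>z. z \<in> L \<and> f \<epsilon> (x \<epsilon>) - f \<epsilon> (y \<epsilon>) = (\<Sum>i\<in>UNIV. h \<epsilon> $ i * partial_deriv i (f \<epsilon>) z)"
    if "G \<epsilon>" for \<epsilon>
  proof -
    have "closed_segment (y \<epsilon>) (y \<epsilon> + h \<epsilon>) \<subseteq> L"
    proof
      fix w
      assume "w \<in> closed_segment (y \<epsilon>) (y \<epsilon> + h \<epsilon>)"
      then obtain t where t: "0 \<le> t" "t \<le> 1" "w = (1 - t) *\<^sub>R y \<epsilon> + t *\<^sub>R (y \<epsilon> + h \<epsilon>)"
        unfolding closed_segment_def by blast
      from t(3) have "w = y \<epsilon> + t *\<^sub>R h \<epsilon>"
        by (simp add: algebra_simps)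
      then show "w \<in> L"
        using near[OF that t(1,2)] by simp
    qed
    then have segment: "closed_segment (y \<epsilon>) (y \<epsilon> + h \<epsilon>) \<subseteq> \<Omega>"
      using \<open>L \<subseteq> \<Omega>\<close> by (rule order_trans)
    have smooth: "smooth_on \<Omega> (f \<epsilon>)"
      using assms(2) that by (simp add: moderate_functions_def G_def)
    obtain t where t: "0 \<le> t" "t \<le> 1"
      "f \<epsilon> (y \<epsilon> + h \<epsilon>) - f \<epsilon> (y \<epsilon>) = (\<Sum>i\<in>UNIV. h \<epsilon> $ i * partial_deriv i (f \<epsilon>) (y \<epsilon> + t *\<^sub>R h \<epsilon>))"
      by (rule mean_value_segment[OF assms(1) smooth segment])
    with near[OF that t(1,2)] show ?thesis
      by (auto simp: h_def)
  qed
  then obtain z where z: "\<And>\<epsilon>. G \<epsilon> \<Longrightarrow> z \<epsilon> \<in> L"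
    "\<And>\<epsilon>. G \<epsilon> \<Longrightarrow> f \<epsilon> (x \<epsilon>) - f \<epsilon> (y \<epsilon>) = (\<Sum>i\<in>UNIV. h \<epsilon> $ i * partial_deriv i (f \<epsilon>) (z \<epsilon>))"
    by metis
  have "\<forall>\<^sub>F \<epsilon> in at_right 0. z \<epsilon> \<in> L"
    using G_ev by eventually_elim (rule z)
  then have "moderate (\<lambda>\<epsilon>. iter_partial [i] (f \<epsilon>) (z \<epsilon>))" for i
    using assms(2) L \<open>L \<subseteq> \<Omega>\<close> unfolding moderate_functions_iff by blast
  then have "moderate (\<lambda>\<epsilon>. partial_deriv i (f \<epsilon>) (z \<epsilon>))" for i
    by (simp add: iter_partial_Cons iter_partial_Nil)
  moreover have "negligible_net (\<lambda>\<epsilon>. h \<epsilon> $ i)" for i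
    using component_le_norm_cart[of "h _" i]
    by (intro negligible_net_dominated[OF xy]) (simp add: h_def)
  ultimately have "negligible_net (\<lambda>\<epsilon>. \<Sum>i\<in>UNIV. partial_deriv i (f \<epsilon>) (z \<epsilon>) * h \<epsilon> $ i)"
    by (intro negligible_net_sum negligible_net_mult) auto
  then show ?thesis
    by (rule negligible_net_dominated) (use G_ev in \<open>eventually_elim, simp add: z mult.commute\<close>)
qed

lemma point_value_eq:
  assumes "open \<Omega>" "f \<in> moderate_functions \<Omega>" "\<Omega>' \<subseteq> \<Omega>" "x \<in> compact_nets \<Omega>'"
  shows "point_value (colombeau_rel \<Omega> `` {f}) (point_rel \<Omega>' `` {x}) = GenReal (\<lambda>\<epsilon>. f \<epsilon> (x \<epsilon>))"
  unfolding point_value_def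
proof (rule the_equality)
  have "f \<in> colombeau_rel \<Omega> `` {f}"
    by (rule equiv_class_self[OF equiv_colombeau_rel[OF assms(1)] assms(2)])
  moreover have "x \<in> point_rel \<Omega>' `` {x}"
    by (rule equiv_class_self[OF equiv_point_rel assms(4)])
  ultimately show "\<exists>f'\<in>colombeau_rel \<Omega> `` {f}. \<exists>x'\<in>point_rel \<Omega>' `` {x}.
      GenReal (\<lambda>\<epsilon>. f \<epsilon> (x \<epsilon>)) = GenReal (\<lambda>\<epsilon>. f' \<epsilon> (x' \<epsilon>))"
    by blast
  fix r
  assume "\<exists>f'\<in>colombeau_rel \<Omega> `` {f}. \<exists>x'\<in>point_rel \<Omega>' `` {x}. r = GenReal (\<lambda>\<epsilon>. f' \<epsilon> (x' \<epsilon>))"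
  then obtain g y where g: "(f, g) \<in> colombeau_rel \<Omega>" and y: "(x, y) \<in> point_rel \<Omega>'"
    and r: "r = GenReal (\<lambda>\<epsilon>. g \<epsilon> (y \<epsilon>))"
    by blast
  have g_mod: "g \<in> moderate_functions \<Omega>" and y_net: "y \<in> compact_nets \<Omega>'"
    using g y by (auto simp: colombeau_rel_def point_rel_def)
  obtain K where K: "compact K" "K \<subseteq> \<Omega>" "\<forall>\<^sub>F \<epsilon> in at_right 0. x \<epsilon> \<in> K"
    using assms(4,3) by (rule compact_nets_eventually)
  then have "negligible_net (\<lambda>\<epsilon>. iter_partial [] (f \<epsilon>) (x \<epsilon>) - iter_partial [] (g \<epsilon>) (x \<epsilon>))"
    using g unfolding colombeau_rel_iff[OF assms(1)] by blast
  then have "negligible_net (\<lambda>\<epsilon>. f \<epsilon> (x \<epsilon>) - g \<epsilon> (x \<epsilon>))"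
    by (simp add: iter_partial_Nil)
  moreover have "negligible_net (\<lambda>\<epsilon>. g \<epsilon> (x \<epsilon>) - g \<epsilon> (y \<epsilon>))"
    using y by (intro negligible_point_value_diff[OF assms(1) g_mod assms(4,3)]) (simp add: point_rel_def)
  ultimately have "negligible_net (\<lambda>\<epsilon>. f \<epsilon> (x \<epsilon>) - g \<epsilon> (x \<epsilon>) + (g \<epsilon> (x \<epsilon>) - g \<epsilon> (y \<epsilon>)))"
    by (rule negligible_net_add)
  then have "GenReal (\<lambda>\<epsilon>. f \<epsilon> (x \<epsilon>)) = GenReal (\<lambda>\<epsilon>. g \<epsilon> (y \<epsilon>))"
    using moderate_point_value[OF assms(2,4,3)] moderate_point_value[OF g_mod y_net assms(3)]
    by (simp add: GenReal_eq_iff)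
  then show "r = GenReal (\<lambda>\<epsilon>. f \<epsilon> (x \<epsilon>))"
    by (simp add: r)
qed

lemma gen_gradient_eq:
  assumes "open \<Omega>" "f \<in> moderate_functions \<Omega>" "\<Omega>' \<subseteq> \<Omega>" "x \<in> compact_nets \<Omega>'"
  shows "gen_gradient \<Omega> (colombeau_rel \<Omega> `` {f}) (point_rel \<Omega>' `` {x}) =
    (\<chi> i. GenReal (\<lambda>\<epsilon>. partial_deriv i (f \<epsilon>) (x \<epsilon>)))"
  using assms
  by (simp add: gen_gradient_def colombeau_partial_class point_value_eq moderate_functions_partial_deriv)

lemma gen_hessian_eq:
  assumes "open \<Omega>" "f \<in> moderate_functions \<Omega>" "\<Omega>' \<subseteq> \<Omega>" "x \<in> compact_nets \<Omega>'"
  shows "gen_hessian \<Omega> (colombeau_rel \<Omega> `` {f}) (point_rel \<Omega>' `` {x}) =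
    (\<chi> i j. GenReal (\<lambda>\<epsilon>. partial_deriv i (partial_deriv j (f \<epsilon>)) (x \<epsilon>)))"
  using assms
  by (simp add: gen_hessian_def colombeau_partial_class point_value_eq moderate_functions_partial_deriv)

section \<open>Minima\<close>

lemma moderate_compact_net_component:
  assumes "x \<in> compact_nets \<Omega>"
  shows "moderate (\<lambda>\<epsilon>. x \<epsilon> $ i)"
proof -
  obtain K where K: "compact K" "\<forall>\<^sub>F \<epsilon> in at_right 0. x \<epsilon> \<in> K"
    using assms unfolding compact_nets_def by blast
  obtain B where B: "\<And>z. z \<in> K \<Longrightarrow> norm z \<le> B"
    using compact_imp_bounded[OF K(1)] unfolding bounded_iff by blast
  show ?thesis
  proof (rule moderate_dominated[OF moderate_const[of B]])
    show "\<forall>\<^sub>F \<epsilon> in at_right 0. \<bar>x \<epsilon> $ i\<bar> \<le> \<bar>B\<bar>"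
      using K(2)
    proof eventually_elim
      case (elim \<epsilon>)
      then show ?case
        using B[of "x \<epsilon>"] component_le_norm_cart[of "x \<epsilon>" i] by simp
    qed
  qed
qed

lemma compact_nets_const: "x0 \<in> \<Omega> \<Longrightarrow> (\<lambda>_. x0) \<in> compact_nets \<Omega>"
  by (auto simp: compact_nets_def intro!: exI[of _ "{x0}"])

text \<open>
  If \<open>x\<^sub>\<epsilon>\<close> eventually lies in the compact set \<open>K\<close>, then the new net eventually lies in the union of
  all segments from \<open>x\<^sub>0\<close> to points of \<open>K\<close>, a continuous image of \<open>[0, 1] \<times> K\<close>.
\<close>

lemma compact_nets_star_shaped:
  assumes star: "\<forall>x\<in>\<Omega>'. closed_segment x0 x \<subseteq> \<Omega>'" and x: "x \<in> compact_nets \<Omega>'"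
    and t: "\<And>\<epsilon>. \<epsilon> \<in> {0<..1} \<Longrightarrow> 0 \<le> t \<epsilon> \<and> t \<epsilon> \<le> 1"
  shows "(\<lambda>\<epsilon>. x0 + t \<epsilon> *\<^sub>R (x \<epsilon> - x0)) \<in> compact_nets \<Omega>'"
proof -
  have in_star: "x0 + s *\<^sub>R (z - x0) \<in> \<Omega>'" if "z \<in> \<Omega>'" "0 \<le> s" "s \<le> 1" for s z
  proof -
    have "x0 + s *\<^sub>R (z - x0) = (1 - s) *\<^sub>R x0 + s *\<^sub>R z"
      by (simp add: algebra_simps)
    then have "x0 + s *\<^sub>R (z - x0) \<in> closed_segment x0 z"
      using that by (auto simp: closed_segment_def)
    then show ?thesis
      using star that(1) by blast
  qed
  obtain K where K: "compact K" "K \<subseteq> \<Omega>'" "\<forall>\<^sub>F \<epsilon> in at_right 0. x \<epsilon> \<in> K"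
    using x order_refl by (rule compact_nets_eventually)
  define L where "L = (\<lambda>(s, z). x0 + s *\<^sub>R (z - x0)) ` ({0..1} \<times> K)"
  have "compact L"
    unfolding L_def by (intro compact_continuous_image compact_Times K(1) compact_Icc)
      (auto simp: case_prod_beta intro!: continuous_intros)
  moreover have "L \<subseteq> \<Omega>'"
    using K(2) in_star by (auto simp: L_def)
  moreover have "\<forall>\<^sub>F \<epsilon> in at_right 0. x0 + t \<epsilon> *\<^sub>R (x \<epsilon> - x0) \<in> L"
    using K(3) eventually_unit_interval
  proof eventually_elim
    case (elim \<epsilon>)
    then have "(t \<epsilon>, x \<epsilon>) \<in> {0..1} \<times> K"
      using t[of \<epsilon>] by simp
    then show ?case
      unfolding L_def by (rule rev_image_eqI) simp
  qed
  ultimately show ?thesis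
    using x t in_star by (auto simp: compact_nets_def)
qed

text \<open>
  Taylor's formula at a critical point, at the level of classes. The vector \<open>\<xi>\<close> is the class of
  \<open>x\<^sub>\<epsilon> - x\<^sub>0\<close>, and \<open>Y\<close> is the class of the intermediate points. The last claim expresses that
  \<open>\<xi>\<close> measures the distance between \<open>X\<close> and \<open>x\<^sub>0\<close>; it serves the uniqueness of the minimum.
\<close>

lemma point_value_Taylor:
  fixes \<Omega> \<Omega>' :: "(real ^ 'n) set"
  assumes "open \<Omega>" "F \<in> colombeau_algebra \<Omega>" "\<Omega>' \<subseteq> \<Omega>" "x0 \<in> \<Omega>'"
    and star: "\<forall>x\<in>\<Omega>'. closed_segment x0 x \<subseteq> \<Omega>'"
    and gradient: "gen_gradient \<Omega> F (std_point \<Omega> x0) = 0"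
    and X: "X \<in> gen_points \<Omega>'"
  obtains Y and \<xi> :: "gen_real ^ 'n" where "Y \<in> gen_points \<Omega>'"
    "point_value F X - point_value F (std_point \<Omega>' x0) =
      GenReal (\<lambda>_. 1 / 2) * scalar_product \<xi> (gen_hessian \<Omega> F Y *v \<xi>)"
    "\<xi> = 0 \<Longrightarrow> X = std_point \<Omega>' x0"
proof -
  obtain f where f: "f \<in> moderate_functions \<Omega>" and F: "F = colombeau_rel \<Omega> `` {f}"
    using assms(2) unfolding colombeau_algebra_def by (auto elim: quotientE)
  obtain x where x: "x \<in> compact_nets \<Omega>'" and X_eq: "X = point_rel \<Omega>' `` {x}"
    using X unfolding gen_points_def by (auto elim: quotientE)
  have x0: "(\<lambda>_. x0) \<in> compact_nets \<Omega>'" "(\<lambda>_. x0) \<in> compact_nets \<Omega>"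
    using assms(3,4) by (auto intro: compact_nets_const)
  define h where "h \<epsilon> = x \<epsilon> - x0" for \<epsilon>
  define Taylor_at where "Taylor_at \<epsilon> s \<longleftrightarrow> f \<epsilon> (x0 + h \<epsilon>) - f \<epsilon> x0 = (\<Sum>i\<in>UNIV. h \<epsilon> $ i * partial_deriv i (f \<epsilon>) x0) +
      1 / 2 * (\<Sum>i\<in>UNIV. h \<epsilon> $ i * (\<Sum>j\<in>UNIV.
        partial_deriv i (partial_deriv j (f \<epsilon>)) (x0 + s *\<^sub>R h \<epsilon>) * h \<epsilon> $ j))" for \<epsilon> s
  have "\<exists>s. 0 \<le> s \<and> s \<le> 1 \<and> Taylor_at \<epsilon> s" if "\<epsilon> \<in> {0<..1}" for \<epsilon>
  proof -
    have smooth: "smooth_on \<Omega> (f \<epsilon>)"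
      using f that by (simp add: moderate_functions_def)
    have "x \<epsilon> \<in> \<Omega>'"
      using x that by (simp add: compact_nets_def)
    then have "closed_segment x0 (x0 + h \<epsilon>) \<subseteq> \<Omega>"
      using star assms(3) by (simp add: h_def) blast
    from second_order_Taylor_segment[OF assms(1) smooth this] show ?thesis
      unfolding Taylor_at_def by blast
  qed
  then obtain t where t: "\<And>\<epsilon>. \<epsilon> \<in> {0<..1} \<Longrightarrow> 0 \<le> t \<epsilon> \<and> t \<epsilon> \<le> 1"
    and Taylor: "\<And>\<epsilon>. \<epsilon> \<in> {0<..1} \<Longrightarrow> Taylor_at \<epsilon> (t \<epsilon>)"
    by metis
  define y where "y \<epsilon> = x0 + t \<epsilon> *\<^sub>R h \<epsilon>" for \<epsilon>
  have y: "y \<in> compact_nets \<Omega>'"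
    using compact_nets_star_shaped[OF star x t] by (simp add: y_def[abs_def] h_def)
  define \<xi> where "\<xi> = (\<chi> i. GenReal (\<lambda>\<epsilon>. h \<epsilon> $ i))"
  have h_mod: "moderate (\<lambda>\<epsilon>. h \<epsilon> $ i)" for i
    using moderate_add[OF moderate_compact_net_component[OF x] moderate_const[of "- (x0 $ i)"], of i]
    by (simp add: h_def)
  have g_mod: "moderate (\<lambda>\<epsilon>. partial_deriv i (f \<epsilon>) x0)" for i
    by (rule moderate_point_value[OF moderate_functions_partial_deriv[OF f] x0(1) assms(3)])
  have H_mod: "moderate (\<lambda>\<epsilon>. partial_deriv i (partial_deriv j (f \<epsilon>)) (y \<epsilon>))" for i j
    by (rule moderate_point_value[OF moderate_functions_partial_deriv[OF moderate_functions_partial_deriv[OF f]]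
          y assms(3)])
  note mods = h_mod g_mod H_mod moderate_mult moderate_sum moderate_const
  have grad: "GenReal (\<lambda>\<epsilon>. partial_deriv i (f \<epsilon>) x0) = 0" for i
    using gradient gen_gradient_eq[OF assms(1) f order_refl x0(2)]
    by (simp add: F std_point_def vec_eq_iff)
  have fx_mod: "moderate (\<lambda>\<epsilon>. f \<epsilon> (x \<epsilon>))" "moderate (\<lambda>\<epsilon>. f \<epsilon> x0)"
    by (rule moderate_point_value[OF f x assms(3)], rule moderate_point_value[OF f x0(1) assms(3)])
  have "point_value F X - point_value F (std_point \<Omega>' x0) = GenReal (\<lambda>\<epsilon>. f \<epsilon> (x \<epsilon>) - f \<epsilon> x0)"
    unfolding F X_eq std_point_def point_value_eq[OF assms(1) f assms(3) x]
      point_value_eq[OF assms(1) f assms(3) x0(1)]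
    by (rule GenReal_diff[OF fx_mod])
  also have "\<dots> = GenReal (\<lambda>\<epsilon>. (\<Sum>i\<in>UNIV. h \<epsilon> $ i * partial_deriv i (f \<epsilon>) x0) +
      1 / 2 * (\<Sum>i\<in>UNIV. h \<epsilon> $ i * (\<Sum>j\<in>UNIV.
        partial_deriv i (partial_deriv j (f \<epsilon>)) (y \<epsilon>) * h \<epsilon> $ j)))"
  proof (rule GenReal_cong)
    show "moderate (\<lambda>\<epsilon>. (\<Sum>i\<in>UNIV. h \<epsilon> $ i * partial_deriv i (f \<epsilon>) x0) +
      1 / 2 * (\<Sum>i\<in>UNIV. h \<epsilon> $ i * (\<Sum>j\<in>UNIV.
        partial_deriv i (partial_deriv j (f \<epsilon>)) (y \<epsilon>) * h \<epsilon> $ j)))"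
      by (intro moderate_add mods finite)
  qed (use Taylor in \<open>simp add: Taylor_at_def y_def h_def\<close>)
  also have "\<dots> = (\<Sum>i\<in>UNIV. GenReal (\<lambda>\<epsilon>. h \<epsilon> $ i) * GenReal (\<lambda>\<epsilon>. partial_deriv i (f \<epsilon>) x0)) +
      GenReal (\<lambda>_. 1 / 2) * (\<Sum>i\<in>UNIV. GenReal (\<lambda>\<epsilon>. h \<epsilon> $ i) * (\<Sum>j\<in>UNIV.
        GenReal (\<lambda>\<epsilon>. partial_deriv i (partial_deriv j (f \<epsilon>)) (y \<epsilon>)) * GenReal (\<lambda>\<epsilon>. h \<epsilon> $ j)))"
    \<comment> \<open>The factor \<open>1 / 2\<close> must stay a factor in order to be recognized as a constant net.\<close>
    by (simp add: GenReal_add GenReal_mult GenReal_sum mods del: times_divide_eq_left)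
  also have "\<dots> = GenReal (\<lambda>_. 1 / 2) * scalar_product \<xi> (gen_hessian \<Omega> F (point_rel \<Omega>' `` {y}) *v \<xi>)"
    unfolding F gen_hessian_eq[OF assms(1) f assms(3) y]
    by (simp add: grad scalar_product_def matrix_vector_mult_def \<xi>_def)
  finally have eq: "point_value F X - point_value F (std_point \<Omega>' x0) =
      GenReal (\<lambda>_. 1 / 2) * scalar_product \<xi> (gen_hessian \<Omega> F (point_rel \<Omega>' `` {y}) *v \<xi>)" .
  have X_std: "X = std_point \<Omega>' x0" if "\<xi> = 0"
  proof -
    have "negligible_net (\<lambda>\<epsilon>. \<bar>h \<epsilon> $ i\<bar>)" for i
    proof -
      have "GenReal (\<lambda>\<epsilon>. h \<epsilon> $ i) = GenReal (\<lambda>_. 0)"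
        using that by (simp add: \<xi>_def vec_eq_iff GenReal_zero)
      then have "negligible_net (\<lambda>\<epsilon>. h \<epsilon> $ i)"
        using GenReal_eq_iff[OF h_mod[of i] moderate_const[of 0]] by simp
      then show ?thesis
        by (rule negligible_net_dominated) simp
    qed
    then have "negligible_net (\<lambda>\<epsilon>. \<Sum>i\<in>UNIV. \<bar>h \<epsilon> $ i\<bar>)"
      by (intro negligible_net_sum) auto
    then have "negligible_net (\<lambda>\<epsilon>. norm (x \<epsilon> - x0))"
      by (rule negligible_net_dominated)
        (use norm_le_l1_cart[of "h _"] in \<open>auto simp: h_def intro!: always_eventually order_trans[OF _ abs_ge_self]\<close>)
    then have "(x, \<lambda>_. x0) \<in> point_rel \<Omega>'"
      using x x0(1) by (simp add: point_rel_def)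
    then show ?thesis
      unfolding X_eq std_point_def by (rule equiv_class_eq[OF equiv_point_rel])
  qed
  have "point_rel \<Omega>' `` {y} \<in> gen_points \<Omega>'"
    using y unfolding gen_points_def by (rule quotientI)
  from that[OF this eq X_std] show thesis .
qed

theorem proposition2p5:
  fixes \<Omega> \<Omega>' :: "(real ^ 'n) set" and x0 :: "real ^ 'n"
    and F :: "(real \<Rightarrow> real ^ 'n \<Rightarrow> real) set"
  assumes "open \<Omega>"
    and "F \<in> colombeau_algebra \<Omega>"
    and "x0 \<in> \<Omega>"
    and "gen_gradient \<Omega> F (std_point \<Omega> x0) = 0"
    and "\<Omega>' \<subseteq> \<Omega>" and "x0 \<in> interior \<Omega>'"
    and "\<forall>x\<in>\<Omega>'. closed_segment x0 x \<subseteq> \<Omega>'"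
    and "\<forall>X\<in>gen_points \<Omega>'. pos_semidefinite (gen_hessian \<Omega> F X)"
  shows "minimum_point F (gen_points \<Omega>') (std_point \<Omega>' x0) \<and>
    ((\<forall>X\<in>gen_points \<Omega>'. pos_definite (gen_hessian \<Omega> F X)) \<longrightarrow>
      (\<forall>X. minimum_point F (gen_points \<Omega>') X \<longrightarrow> X = std_point \<Omega>' x0))"
proof -
  have x0: "x0 \<in> \<Omega>'"
    using assms(6) interior_subset by blast
  note Taylor = point_value_Taylor[OF assms(1,2,5) x0 assms(7,4)]
  have std: "std_point \<Omega>' x0 \<in> gen_points \<Omega>'"
    unfolding std_point_def gen_points_def by (intro quotientI compact_nets_const x0)
  have min: "point_value F (std_point \<Omega>' x0) \<le> point_value F X" if X: "X \<in> gen_points \<Omega>'" for X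
  proof -
    obtain Y \<xi> where Y: "Y \<in> gen_points \<Omega>'"
      and eq: "point_value F X - point_value F (std_point \<Omega>' x0) =
        GenReal (\<lambda>_. 1 / 2) * scalar_product \<xi> (gen_hessian \<Omega> F Y *v \<xi>)"
      using Taylor[OF X] by metis
    have "0 \<le> scalar_product \<xi> (gen_hessian \<Omega> F Y *v \<xi>)"
      using assms(8) Y by (simp add: pos_semidefinite_def)
    then have "0 \<le> point_value F X - point_value F (std_point \<Omega>' x0)"
      unfolding eq by (intro mult_nonneg_nonneg GenReal_const_nonneg) simp_all
    then show ?thesis
      by simp
  qed
  have "X = std_point \<Omega>' x0"
    if definite: "\<forall>X\<in>gen_points \<Omega>'. pos_definite (gen_hessian \<Omega> F X)"
      and X: "minimum_point F (gen_points \<Omega>') X" for X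
  proof -
    have X_point: "X \<in> gen_points \<Omega>'" and le: "point_value F X \<le> point_value F (std_point \<Omega>' x0)"
      using X std by (auto simp: minimum_point_def)
    obtain Y \<xi> where Y: "Y \<in> gen_points \<Omega>'"
      and eq: "point_value F X - point_value F (std_point \<Omega>' x0) =
        GenReal (\<lambda>_. 1 / 2) * scalar_product \<xi> (gen_hessian \<Omega> F Y *v \<xi>)"
      and zero: "\<xi> = 0 \<Longrightarrow> X = std_point \<Omega>' x0"
      using Taylor[OF X_point] by metis
    have "GenReal (\<lambda>_. 1 / 2) * scalar_product \<xi> (gen_hessian \<Omega> F Y *v \<xi>) = 0"
      using eq le min[OF X_point] by simp
    moreover have "GenReal (\<lambda>_. 2) * GenReal (\<lambda>_. 1 / 2) = 1"
      by (simp add: GenReal_mult moderate_const GenReal_one)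
    ultimately have "scalar_product \<xi> (gen_hessian \<Omega> F Y *v \<xi>) = 0"
      by (metis mult.assoc mult_1 mult_zero_right)
    then show ?thesis
      using definite Y zero pos_definite_quadratic_form_eq_0 by blast
  qed
  with std min show ?thesis
    by (auto simp: minimum_point_def)
qed

end
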